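(* Let $\mathbb{F}$ be an algebraically closed field of characteristic $p>2$, let $L$ be a restricted Lie superalgebra over $\mathbb{F}$, and let the superspaces $M,N$ be two restricted $L$-modules. Then the set $\mathrm{Ext}_{\mathrm{res.}}(N,M)$ of equivalence classes of restricted extensions of $N$ by $M$ is in one-to-one correspondence with $H^1_*(L;\mathrm{Hom}_{\mathbb F}(N,M))$. In particular, $\mathrm{Ext}_{\mathrm{res.}}(\mathbb{F},M)$ is in one-to-one correspondence with $H^1_*(L;M)$.
   Context: $|x|\in\mathbb{Z}_2$ denotes the parity of a homogeneous element $x$; formulas involving parities are stated for homogeneous elements and extended linearly. A Lie superalgebra is a superspace $L=L_{\bar0}\oplus L_{\bar1}$ with an even bilinear bracket satisfying $[x,y]=-(-1)^{|x||y|}[y,x]$ and $[x,[y,z]]=[[x,y],z]+(-1)^{|x||y|}[y,[x,z]]$. A restricted Lie superalgebra is a Lie superalgebra $L$ with a map $[p]:L_{\bar0}\to L_{\bar0}$, $x\mapsto x^{[p]}$, such that $(L_{\bar0},[p])$ is a restricted Lie algebra and $L_{\bar1}$ is a restricted $L_{\bar0}$-module. An $L$-module is a superspace $V=V_{\bar0}\oplus V_{\bar1}$ with an action of $L$ (in the usual sense for Lie superalgebras), so that $[x,y]v=x(yv)-(-1)^{|x||y|}y(xv)$ for $x,y\in L$, $v\in V$; it is restricted if moreover $x^{[p]}v=x^pv$ for $x\in L_{\bar0}$, $v\in V$. The field $\mathbb F$ is regarded as the one-dimensional trivial $L$-module. A restricted extension of $N$ by $M$ is an exact sequence $0\to M\xrightarrow{\iota}E\xrightarrow{\pi}N\to0$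 of restricted $L$-modules and homomorphisms. Two extensions $E_1,E_2$ of $N$ by $M$ (with maps $\iota_i,\pi_i$) are equivalent if there is an isomorphism of restricted $L$-modules $\sigma:E_1\to E_2$ with $\sigma\iota_1=\iota_2$ and $\pi_2\sigma=\pi_1$. $\mathrm{Ext}_{\mathrm{res.}}(N,M)$ is the set of equivalence classes of extensions of $N$ by $M$. $\mathrm{Hom}_{\mathbb F}(N,M)$ is a restricted $L$-module via $(x\phi)(n)=x\phi(n)-(-1)^{|\phi||x|}\phi(xn)$ for $x\in L$, $\phi\in\mathrm{Hom}_{\mathbb F}(N,M)$, $n\in N$. Restricted cohomology in degree $1$: for a restricted $L$-module $V$ put $C^0_*(L;V)=\mathrm{Hom}_{\mathbb F}(\mathbb F,V)\cong V$ and $C^1_*(L;V)=\mathrm{Hom}_{\mathbb F}(L,V)$, both naturally $\mathbb Z_2$-graded. Define $d^0_*(v)(x)=(-1)^{|x||v|}xv$ for $v\in V$, $x\in L$. For $\varphi\in C^1_*(L;V)$ define $$d^1\varphi(x,y)=-\varphi([x,y])+(-1)^{|x||\varphi|}x\varphi(y)-(-1)^{|y|(|x|+|\varphi|)}y\varphi(x)\quad(x,y\in L),$$ $$\mathrm{ind}^1(\varphi)(z)=\varphi(z^{[p]})-z^{p-1}\varphi(z)\quad(z\in L_{\bar0}),$$ and $d^1_*(\varphi)=(d^1\varphi,\mathrm{ind}^1(\varphi))$. Then $Z^1_*(L;V)=\mathrm{Ker}\,d^1_*$, $B^1_*(L;V)=\mathrm{Im}\,d^0_*$ and $H^1_*(L;V)=Z^1_*(L;V)/B^1_*(L;V)$.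 *)

theory Defs
  imports
    "HOL-Computational_Algebra.Computational_Algebra"
    "HOL-Library.Z2"
    "HOL-Library.Function_Algebras"
    "HOL-Library.Product_Plus"
begin

section \<open>Superspaces\<close>

text \<open>
  Parities are elements of the two-element field \<^typ>\<open>bit\<close>; \<open>parity_sign a\<close> is $(-1)^a$.
  A superspace is a pair of independent subspaces \<open>hpart V 0\<close>, \<open>hpart V 1\<close> of a vector space
  given by a type; its underlying space \<open>carrier_of V\<close> is their sum, which need not be the whole
  type. This is needed because spaces of linear maps, and the middle terms of extensions, do not
  exhaust a type.
\<close>

definition parity_sign :: "bit \<Rightarrow> 'f::comm_ring_1" where
  "parity_sign a = (if a = 0 then 1 else - 1)"

record ('f, 'v) superspace =
  scale :: "'f \<Rightarrow> 'v \<Rightarrow> 'v"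
  hpart :: "bit \<Rightarrow> 'v set"

definition carrier_of :: "('f, 'v::ab_group_add, 'x) superspace_scheme \<Rightarrow> 'v set" where
  "carrier_of V = {u + v | u v. u \<in> hpart V 0 \<and> v \<in> hpart V 1}"

definition component :: "('f, 'v::ab_group_add, 'x) superspace_scheme \<Rightarrow> bit \<Rightarrow> 'v \<Rightarrow> 'v" where
  "component V a v = (THE u. u \<in> hpart V a \<and> v - u \<in> hpart V (a + 1))"

locale superspace = vector_space "scale V"
  for V :: "('f::field, 'v::ab_group_add, 'x) superspace_scheme" +
  assumes subspace_hpart: "\<And>a. subspace (hpart V a)"
    and hparts_independent: "hpart V 0 \<inter> hpart V 1 = {0}"

definition linear_map ::
  "('f, 'v::ab_group_add, 'x) superspace_scheme \<Rightarrow> ('f, 'w::ab_group_add, 'y) superspace_scheme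
    \<Rightarrow> ('v \<Rightarrow> 'w) \<Rightarrow> bool" where
  "linear_map V W f \<longleftrightarrow>
     (\<forall>v\<in>carrier_of V. f v \<in> carrier_of W) \<and>
     (\<forall>u\<in>carrier_of V. \<forall>v\<in>carrier_of V. f (u + v) = f u + f v) \<and>
     (\<forall>c. \<forall>v\<in>carrier_of V. f (scale V c v) = scale W c (f v))"

text \<open>
  The superspace of all linear maps. It is only used when \<open>carrier_of V = UNIV\<close>, so that a linear
  map is determined by its values on \<open>carrier_of V\<close>.
\<close>

definition Hom_space ::
  "('f, 'v::ab_group_add, 'x) superspace_scheme \<Rightarrow> ('f, 'w::ab_group_add, 'y) superspace_scheme
    \<Rightarrow> ('f, 'v \<Rightarrow> 'w) superspace" where
  "Hom_space V W =
     \<lparr>scale = (\<lambda>c f v. scale W c (f v)),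
      hpart = (\<lambda>a. {f. linear_map V W f \<and> (\<forall>b. \<forall>v\<in>hpart V b. f v \<in> hpart W (a + b))})\<rparr>"


section \<open>Restricted Lie superalgebras\<close>

record ('f, 'l) lie_superalgebra = "('f, 'l) superspace" +
  bracket :: "'l \<Rightarrow> 'l \<Rightarrow> 'l"
  pmap :: "'l \<Rightarrow> 'l"

locale lie_superalgebra = superspace L
  for L :: "('f::field, 'l::ab_group_add, 'x) lie_superalgebra_scheme" +
  assumes carrier_UNIV: "carrier_of L = UNIV"
    and linear_bracket_right: "\<And>x. linear_map L L (bracket L x)"
    and linear_bracket_left: "\<And>y. linear_map L L (\<lambda>x. bracket L x y)"
    and bracket_even: "\<And>a b x y. x \<in> hpart L a \<Longrightarrow> y \<in> hpart L b \<Longrightarrow> bracket L x y \<in> hpart L (a + b)"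
    and bracket_skew: "\<And>a b x y. x \<in> hpart L a \<Longrightarrow> y \<in> hpart L b \<Longrightarrow>
      bracket L x y = - scale L (parity_sign (a * b)) (bracket L y x)"
    and bracket_Jacobi: "\<And>a b c x y z. x \<in> hpart L a \<Longrightarrow> y \<in> hpart L b \<Longrightarrow> z \<in> hpart L c \<Longrightarrow>
      bracket L x (bracket L y z) =
        bracket L (bracket L x y) z + scale L (parity_sign (a * b)) (bracket L y (bracket L x z))"

text \<open>
  \<open>ad_pencil L x y\<close> is the operator $\mathrm{ad}(tx+y)$ on $L\otimes F[t]$, and
  \<open>jacobson_s L x y i\<close> is Jacobson's $s_i(x,y)$: $i\,s_i(x,y)$ is the coefficient of $t^{i-1}$ in
  $\mathrm{ad}(tx+y)^{p-1}(x)$.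
\<close>

definition ad_pencil ::
  "('f, 'l::ab_group_add, 'x) lie_superalgebra_scheme \<Rightarrow> 'l \<Rightarrow> 'l \<Rightarrow> 'l poly \<Rightarrow> 'l poly" where
  "ad_pencil L x y P = pCons 0 (map_poly (bracket L x) P) + map_poly (bracket L y) P"

definition jacobson_s ::
  "('f::field, 'l::ab_group_add, 'x) lie_superalgebra_scheme \<Rightarrow> 'l \<Rightarrow> 'l \<Rightarrow> nat \<Rightarrow> 'l" where
  "jacobson_s L x y i =
     scale L (1 / of_nat i) (coeff ((ad_pencil L x y ^^ (CHAR('f) - 1)) [:x:]) (i - 1))"

text \<open>
  The case \<open>a = 0\<close> of \<open>ad_pmap\<close> is an axiom of the restricted Lie algebra \<open>hpart L 0\<close>,
  the case \<open>a = 1\<close> says that \<open>hpart L 1\<close> is a restricted module over it. Only the values of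
  \<open>pmap L\<close> on \<open>hpart L 0\<close> are meaningful.
\<close>

locale restricted_lie_superalgebra = lie_superalgebra L
  for L :: "('f::field, 'l::ab_group_add, 'x) lie_superalgebra_scheme" +
  assumes pmap_closed: "\<And>x. x \<in> hpart L 0 \<Longrightarrow> pmap L x \<in> hpart L 0"
    and pmap_scale: "\<And>c x. x \<in> hpart L 0 \<Longrightarrow> pmap L (scale L c x) = scale L (c ^ CHAR('f)) (pmap L x)"
    and pmap_add: "\<And>x y. x \<in> hpart L 0 \<Longrightarrow> y \<in> hpart L 0 \<Longrightarrow>
      pmap L (x + y) = pmap L x + pmap L y + (\<Sum>i = 1..CHAR('f) - 1. jacobson_s L x y i)"
    and ad_pmap: "\<And>a x y. x \<in> hpart L 0 \<Longrightarrow> y \<in> hpart L a \<Longrightarrow>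
      bracket L (pmap L x) y = (bracket L x ^^ CHAR('f)) y"


section \<open>Restricted modules and their homomorphisms\<close>

record ('f, 'l, 'v) lmodule = "('f, 'v) superspace" +
  act :: "'l \<Rightarrow> 'v \<Rightarrow> 'v"

locale restricted_module = superspace V
  for L :: "('f::field, 'l::ab_group_add, 'x) lie_superalgebra_scheme"
  and V :: "('f, 'l, 'v::ab_group_add, 'y) lmodule_scheme" +
  assumes linear_act_right: "\<And>x. linear_map V V (act V x)"
    and linear_act_left: "\<And>v. v \<in> carrier_of V \<Longrightarrow> linear_map L V (\<lambda>x. act V x v)"
    and act_even: "\<And>a b x v. x \<in> hpart L a \<Longrightarrow> v \<in> hpart V b \<Longrightarrow> act V x v \<in> hpart V (a + b)"
    and act_bracket: "\<And>a b x y v. x \<in> hpart L a \<Longrightarrow> y \<in> hpart L b \<Longrightarrow> v \<in> carrier_of V \<Longrightarrow>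
      act V (bracket L x y) v =
        act V x (act V y v) - scale V (parity_sign (a * b)) (act V y (act V x v))"
    and act_pmap: "\<And>x v. x \<in> hpart L 0 \<Longrightarrow> v \<in> carrier_of V \<Longrightarrow>
      act V (pmap L x) v = (act V x ^^ CHAR('f)) v"

definition trivial_module :: "('f::field, 'l, 'f) lmodule" where
  "trivial_module = \<lparr>scale = (*), hpart = (\<lambda>a. if a = 0 then UNIV else {0}), act = (\<lambda>x v. 0)\<rparr>"

text \<open>
  The action on a linear map and an element of \<open>L\<close> is
  $(x\phi)(n)=x\phi(n)-(-1)^{|\phi||x|}\phi(xn)$, extended linearly by decomposing both into
  homogeneous components.
\<close>

definition Hom_module ::
  "('f::field, 'l::ab_group_add, 'x) lie_superalgebra_scheme
    \<Rightarrow> ('f, 'l, 'n::ab_group_add, 'y) lmodule_scheme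
    \<Rightarrow> ('f, 'l, 'm::ab_group_add, 'z) lmodule_scheme
    \<Rightarrow> ('f, 'l, 'n \<Rightarrow> 'm) lmodule" where
  "Hom_module L N M =
     \<lparr>scale = scale (Hom_space N M),
      hpart = hpart (Hom_space N M),
      act = (\<lambda>x \<phi> n. \<Sum>a\<in>{0, 1}. \<Sum>k\<in>{0, 1}.
        act M (component L a x) (component (Hom_space N M) k \<phi> n)
        - scale M (parity_sign (k * a))
            (component (Hom_space N M) k \<phi> (act N (component L a x) n)))\<rparr>"

text \<open>
  A homomorphism of parity \<open>k\<close> satisfies $f(xv)=(-1)^{k|x|}xf(v)$. Homomorphisms are not required
  to be even: \<open>lmodule_hom\<close> consists of the sums of an even and an odd one, that is, of the
  $L$-invariant linear maps.
\<close>

definition homogeneous_hom ::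
  "('f::field, 'l::ab_group_add, 'x) lie_superalgebra_scheme
    \<Rightarrow> ('f, 'l, 'v::ab_group_add, 'y) lmodule_scheme
    \<Rightarrow> ('f, 'l, 'w::ab_group_add, 'z) lmodule_scheme \<Rightarrow> bit \<Rightarrow> ('v \<Rightarrow> 'w) set" where
  "homogeneous_hom L V W k =
     {f. linear_map V W f \<and>
         (\<forall>b. \<forall>v\<in>hpart V b. f v \<in> hpart W (k + b)) \<and>
         (\<forall>a. \<forall>x\<in>hpart L a. \<forall>v\<in>carrier_of V.
            f (act V x v) = scale W (parity_sign (k * a)) (act W x (f v)))}"

definition lmodule_hom ::
  "('f::field, 'l::ab_group_add, 'x) lie_superalgebra_scheme
    \<Rightarrow> ('f, 'l, 'v::ab_group_add, 'y) lmodule_scheme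
    \<Rightarrow> ('f, 'l, 'w::ab_group_add, 'z) lmodule_scheme \<Rightarrow> ('v \<Rightarrow> 'w) set" where
  "lmodule_hom L V W =
     {f. \<exists>f0\<in>homogeneous_hom L V W 0. \<exists>f1\<in>homogeneous_hom L V W 1.
           \<forall>v\<in>carrier_of V. f v = f0 v + f1 v}"


section \<open>Restricted extensions\<close>

text \<open>
  An extension $0\to M\to E\to N\to 0$ is a triple \<open>(E, \<iota>, \<pi>)\<close>. The type \<open>'e\<close>, in which the middle
  terms live, plays the role of a universe; it is large enough as soon as it contains a linear copy
  of $M\times N$, since every extension of \<open>N\<close> by \<open>M\<close> is then equivalent to one inside \<open>'e\<close>.
\<close>

type_synonym ('f, 'l, 'n, 'm, 'e) extension =
  "('f, 'l, 'e) lmodule \<times> ('m \<Rightarrow> 'e) \<times> ('e \<Rightarrow> 'n)"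

definition restricted_extensions ::
  "('f::field, 'l::ab_group_add, 'x) lie_superalgebra_scheme
    \<Rightarrow> ('f, 'l, 'n::ab_group_add, 'y) lmodule_scheme
    \<Rightarrow> ('f, 'l, 'm::ab_group_add, 'z) lmodule_scheme
    \<Rightarrow> ('f, 'l, 'n, 'm, 'e::ab_group_add) extension set" where
  "restricted_extensions L N M =
     {(E, \<iota>, \<pi>). restricted_module L E \<and>
        \<iota> \<in> lmodule_hom L M E \<and> \<pi> \<in> lmodule_hom L E N \<and>
        inj_on \<iota> (carrier_of M) \<and>
        \<iota> ` carrier_of M = {e \<in> carrier_of E. \<pi> e = 0} \<and>
        \<pi> ` carrier_of E = carrier_of N}"

definition extension_equivalence ::
  "('f::field, 'l::ab_group_add, 'x) lie_superalgebra_scheme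
    \<Rightarrow> ('f, 'l, 'n::ab_group_add, 'y) lmodule_scheme
    \<Rightarrow> ('f, 'l, 'm::ab_group_add, 'z) lmodule_scheme
    \<Rightarrow> ('f, 'l, 'n, 'm, 'e::ab_group_add) extension rel" where
  "extension_equivalence L N M =
     {((E1, \<iota>1, \<pi>1), (E2, \<iota>2, \<pi>2)).
        (E1, \<iota>1, \<pi>1) \<in> restricted_extensions L N M \<and>
        (E2, \<iota>2, \<pi>2) \<in> restricted_extensions L N M \<and>
        (\<exists>\<sigma>\<in>lmodule_hom L E1 E2. bij_betw \<sigma> (carrier_of E1) (carrier_of E2) \<and>
           (\<forall>m\<in>carrier_of M. \<sigma> (\<iota>1 m) = \<iota>2 m) \<and>
           (\<forall>e\<in>carrier_of E1. \<pi>2 (\<sigma> e) = \<pi>1 e))}"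

definition Ext_res ::
  "('f::field, 'l::ab_group_add, 'x) lie_superalgebra_scheme
    \<Rightarrow> ('f, 'l, 'n::ab_group_add, 'y) lmodule_scheme
    \<Rightarrow> ('f, 'l, 'm::ab_group_add, 'z) lmodule_scheme
    \<Rightarrow> ('f, 'l, 'n, 'm, 'e::ab_group_add) extension set set" where
  "Ext_res L N M = restricted_extensions L N M // extension_equivalence L N M"

definition large_enough ::
  "'e::ab_group_add itself \<Rightarrow> ('f::field, 'n::ab_group_add, 'x) superspace_scheme
    \<Rightarrow> ('f, 'm::ab_group_add, 'y) superspace_scheme \<Rightarrow> bool" where
  "large_enough _ N M \<longleftrightarrow>
     (\<exists>(s :: 'f \<Rightarrow> 'e \<Rightarrow> 'e) (j :: 'm \<times> 'n \<Rightarrow> 'e).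
        Vector_Spaces.linear (\<lambda>c. map_prod (scale M c) (scale N c)) s j \<and> inj j)"


section \<open>Restricted cohomology in degree one\<close>

text \<open>
  $C^0_*(L;V)$ is identified with \<open>V\<close>, and $C^1_*(L;V)$ is the space of all linear maps
  \<open>Hom_space L V\<close>. Formulas involving parities are extended linearly through \<open>component\<close>.
\<close>

definition d0 ::
  "('f::field, 'l::ab_group_add, 'x) lie_superalgebra_scheme
    \<Rightarrow> ('f, 'l, 'v::ab_group_add, 'y) lmodule_scheme \<Rightarrow> 'v \<Rightarrow> 'l \<Rightarrow> 'v" where
  "d0 L V v x = (\<Sum>a\<in>{0, 1}. \<Sum>b\<in>{0, 1}.
     scale V (parity_sign (a * b)) (act V (component L a x) (component V b v)))"

definition d1 ::
  "('f::field, 'l::ab_group_add, 'x) lie_superalgebra_scheme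
    \<Rightarrow> ('f, 'l, 'v::ab_group_add, 'y) lmodule_scheme \<Rightarrow> ('l \<Rightarrow> 'v) \<Rightarrow> 'l \<Rightarrow> 'l \<Rightarrow> 'v" where
  "d1 L V \<phi> x y = (\<Sum>a\<in>{0, 1}. \<Sum>b\<in>{0, 1}. \<Sum>k\<in>{0, 1}.
     let xa = component L a x; yb = component L b y; \<phi>k = component (Hom_space L V) k \<phi> in
       - \<phi>k (bracket L xa yb)
       + scale V (parity_sign (a * k)) (act V xa (\<phi>k yb))
       - scale V (parity_sign (b * (a + k))) (act V yb (\<phi>k xa)))"

definition ind1 ::
  "('f::field, 'l::ab_group_add, 'x) lie_superalgebra_scheme
    \<Rightarrow> ('f, 'l, 'v::ab_group_add, 'y) lmodule_scheme \<Rightarrow> ('l \<Rightarrow> 'v) \<Rightarrow> 'l \<Rightarrow> 'v" where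
  "ind1 L V \<phi> z = \<phi> (pmap L z) - (act V z ^^ (CHAR('f) - 1)) (\<phi> z)"

definition Z1 ::
  "('f::field, 'l::ab_group_add, 'x) lie_superalgebra_scheme
    \<Rightarrow> ('f, 'l, 'v::ab_group_add, 'y) lmodule_scheme \<Rightarrow> ('l \<Rightarrow> 'v) set" where
  "Z1 L V = {\<phi> \<in> carrier_of (Hom_space L V).
     (\<forall>x y. d1 L V \<phi> x y = 0) \<and> (\<forall>z\<in>hpart L 0. ind1 L V \<phi> z = 0)}"

definition B1 ::
  "('f::field, 'l::ab_group_add, 'x) lie_superalgebra_scheme
    \<Rightarrow> ('f, 'l, 'v::ab_group_add, 'y) lmodule_scheme \<Rightarrow> ('l \<Rightarrow> 'v) set" where
  "B1 L V = d0 L V ` carrier_of V"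

definition H1 ::
  "('f::field, 'l::ab_group_add, 'x) lie_superalgebra_scheme
    \<Rightarrow> ('f, 'l, 'v::ab_group_add, 'y) lmodule_scheme \<Rightarrow> ('l \<Rightarrow> 'v) set set" where
  "H1 L V = Z1 L V // {(\<phi>, \<psi>). \<phi> \<in> Z1 L V \<and> \<psi> \<in> Z1 L V \<and> \<phi> - \<psi> \<in> B1 L V}"

end

theory Submission
  imports Defs
begin

text \<open>
  Let $\delta$ be the parity operator and $x * v = x\,\delta^{|x|}v$. Homomorphisms, even or not, are
  exactly the linear maps commuting with all $x*$, and in terms of $*$ the differentials become free
  of the parity of the cochain: $d^0v(x) = x*v$ and
  $d^1\varphi(x,y) = (-1)^{|x||y|}\,x*\varphi(y) - y*\varphi(x) - \varphi([x,y])$. A linear section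
  $s$ of an extension yields the cocycle $\varphi$ with
  $x*s(\delta^{|x|}n) = s(xn) + \iota(\varphi(x)n)$, and two extensions are equivalent iff their
  cocycles are cohomologous. The restrictedness condition corresponds because
  $(l-r)^{p-1} = \sum_i l^{p-1-i}r^i$ for commuting $l, r$ in characteristic $p$, after which the sum
  over a section telescopes.

  The injection of extension classes into $H^1$ so obtained need not be onto, since the middle term of
  an extension has to be graded: if $\varphi$ is inhomogeneous, the module it defines on
  $M\times N$ need not admit a grading. (For instance, for the
  abelian $L = \mathbb F z\oplus\mathbb F y$ with $z$ even, $y$ odd and $z^{[p]} = 0$ and for
  $M = N = \mathbb F$, one has $H^1 = \mathbb F^2$ but only the classes $(a, b)$ with $ab = 0$ come
  from extensions.) All homogeneous classes are attained, by shifting the parity of $M$. As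
  $H^1 = H^1_{\bar 0}\oplus H^1_{\bar 1}$ and $\mathbb F$ is infinite, either one summand vanishes or
  both are infinite; in the first case all classes are attained, in the second the attained classes
  have the same cardinality as $H^1$, and the bijection comes from the Schroeder--Bernstein theorem.
\<close>


section \<open>Homogeneous components and the parity twist\<close>

text \<open>Parities stay ring expressions in \<open>+\<close> and \<open>*\<close>, so that ring
  laws apply to the exponents of signs; the simplifier would otherwise rewrite them to bitwise
  operations.\<close>

declare add_bit_eq_xor [simp del] mult_bit_eq_and [simp del]

lemma bit_add_self [simp]: "a + a = (0::bit)" "a + (a + b) = (b::bit)"
  by (cases a; cases b; simp)+

lemma parity_sign_simps [simp]: "parity_sign 0 = 1" "parity_sign 1 = - 1"
  by (simp_all add: parity_sign_def)

lemma parity_sign_mult_self [simp]: "parity_sign a * parity_sign a = 1"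
  by (cases a) simp_all

lemma parity_sign_add: "parity_sign (a + b) = parity_sign a * parity_sign b"
  by (cases a; cases b) simp_all

lemma sum_bit: "(\<Sum>a\<in>{0, 1::bit}. f a) = f 0 + f 1"
  by simp

text \<open>\<open>twist V a\<close> is the power \<delta>^a of the parity operator: on the carrier,
  the identity for a = 0 and the sign change of the odd part for a = 1. Keeping the exponent as an
  argument allows it to be the parity of an element of \<open>L\<close>.\<close>

definition twist :: "('f::field, 'v::ab_group_add, 'x) superspace_scheme \<Rightarrow> bit \<Rightarrow> 'v \<Rightarrow> 'v" where
  "twist V a v = (\<Sum>c\<in>{0, 1}. scale V (parity_sign (a * c)) (component V c v))"

context superspace
begin

lemma hpart_zero [simp]: "0 \<in> hpart V a"
  using subspace_0[OF subspace_hpart] .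

lemma hpart_add: "u \<in> hpart V a \<Longrightarrow> v \<in> hpart V a \<Longrightarrow> u + v \<in> hpart V a"
  using subspace_add[OF subspace_hpart] .

lemma hpart_diff: "u \<in> hpart V a \<Longrightarrow> v \<in> hpart V a \<Longrightarrow> u - v \<in> hpart V a"
  using subspace_diff[OF subspace_hpart] .

lemma hpart_scale: "u \<in> hpart V a \<Longrightarrow> scale V c u \<in> hpart V a"
  using subspace_scale[OF subspace_hpart] .

lemma hparts_disjoint: "u \<in> hpart V a \<Longrightarrow> u \<in> hpart V b \<Longrightarrow> a \<noteq> b \<Longrightarrow> u = 0"
  using hparts_independent by (cases a; cases b) auto

lemma hpart_carrier: "u \<in> hpart V a \<Longrightarrow> u \<in> carrier_of V"
  unfolding carrier_of_def using hpart_zero by (cases a) force+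

lemma subspace_carrier: "subspace (carrier_of V)"
proof (rule subspaceI)
  show "0 \<in> carrier_of V" by (rule hpart_carrier[OF hpart_zero])
next
  fix x y assume "x \<in> carrier_of V" "y \<in> carrier_of V"
  then obtain u v u' v' where "u \<in> hpart V 0" "v \<in> hpart V 1" "u' \<in> hpart V 0" "v' \<in> hpart V 1"
    "x = u + v" "y = u' + v'" unfolding carrier_of_def by blast
  moreover from this have "x + y = (u + u') + (v + v')" by (simp add: algebra_simps)
  ultimately show "x + y \<in> carrier_of V"
    unfolding carrier_of_def using hpart_add by blast
next
  fix c x assume "x \<in> carrier_of V"
  then show "scale V c x \<in> carrier_of V"
    unfolding carrier_of_def using hpart_scale by (force simp: scale_right_distrib)
qed

lemmas carrier_zero [simp] = subspace_0[OF subspace_carrier]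
lemmas carrier_add = subspace_add[OF subspace_carrier]
lemmas carrier_diff = subspace_diff[OF subspace_carrier]
lemmas carrier_neg = subspace_neg[OF subspace_carrier]
lemmas carrier_scale = subspace_scale[OF subspace_carrier]

text \<open>Two candidates differ by an element of both homogeneous parts, hence by 0. With this,
  the definite description in \<open>component\<close> is evaluated by exhibiting a witness.\<close>

lemma component_unique:
  assumes "u \<in> hpart V a" "v - u \<in> hpart V (a + 1)"
  shows "component V a v = u"
  unfolding component_def
proof (rule the_equality)
  fix w assume w: "w \<in> hpart V a \<and> v - w \<in> hpart V (a + 1)"
  have "u - w = (v - w) - (v - u)" by simp
  then have "u - w \<in> hpart V (a + 1)" "u - w \<in> hpart V a"
    using w assms hpart_diff by metis+
  then show "w = u" using hparts_disjoint[of "u - w" a "a + 1"] by (cases a) auto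
qed (use assms in auto)

lemma component_exists:
  assumes "v \<in> carrier_of V"
  shows "\<exists>u. u \<in> hpart V a \<and> v - u \<in> hpart V (a + 1)"
proof -
  obtain x y where "v = x + y" "x \<in> hpart V 0" "y \<in> hpart V 1"
    using assms unfolding carrier_of_def by blast
  then show ?thesis
    by (cases a) (auto intro: exI[of _ x] exI[of _ y])
qed

lemma component_in: "v \<in> carrier_of V \<Longrightarrow> component V a v \<in> hpart V a"
  using component_exists[of v a] component_unique by metis

lemma component_in_carrier: "v \<in> carrier_of V \<Longrightarrow> component V a v \<in> carrier_of V"
  using component_in hpart_carrier by blast

lemma component_sum: "v \<in> carrier_of V \<Longrightarrow> component V 0 v + component V 1 v = v"
proof -
  assume v: "v \<in> carrier_of V"
  obtain x y where "v = x + y" "x \<in> hpart V 0" "y \<in> hpart V 1"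
    using v unfolding carrier_of_def by blast
  then show ?thesis
    using component_unique[of x 0 v] component_unique[of y 1 v] by simp
qed

lemma component_homogeneous: "v \<in> hpart V a \<Longrightarrow> component V b v = (if b = a then v else 0)"
  by (rule component_unique) (cases a; cases b; simp)+

lemma component_same [simp]: "v \<in> hpart V a \<Longrightarrow> component V a v = v"
  by (simp add: component_homogeneous)

lemma component_zero [simp]: "component V a 0 = 0"
  by simp

lemma component_add:
  assumes "u \<in> carrier_of V" "v \<in> carrier_of V"
  shows "component V a (u + v) = component V a u + component V a v"
proof -
  obtain x y where "x \<in> hpart V a" "u - x \<in> hpart V (a + 1)" "y \<in> hpart V a" "v - y \<in> hpart V (a + 1)"
    using component_exists assms by metis
  moreover have "u + v - (x + y) = (u - x) + (v - y)" by simp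
  ultimately show ?thesis using component_unique hpart_add by metis
qed

lemma component_scale:
  assumes "v \<in> carrier_of V"
  shows "component V a (scale V c v) = scale V c (component V a v)"
proof -
  obtain y where "y \<in> hpart V a" "v - y \<in> hpart V (a + 1)"
    using component_exists assms by metis
  then show ?thesis using component_unique hpart_scale scale_right_diff_distrib by metis
qed

lemma component_neg: "v \<in> carrier_of V \<Longrightarrow> component V a (- v) = - component V a v"
  using component_scale[of v a "-1"] by simp

lemma component_diff:
  "u \<in> carrier_of V \<Longrightarrow> v \<in> carrier_of V \<Longrightarrow> component V a (u - v) = component V a u - component V a v"
  using component_add[of u "- v" a] component_neg[of v a] carrier_neg[of v] by simp

text \<open>Reduces additive statements to homogeneous vectors, where \<open>component\<close> and
  \<open>twist\<close> have closed forms.\<close>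

lemma carrier_induct [consumes 1, case_names add homogeneous]:
  assumes "v \<in> carrier_of V"
    and "\<And>u v. u \<in> carrier_of V \<Longrightarrow> v \<in> carrier_of V \<Longrightarrow> P u \<Longrightarrow> P v \<Longrightarrow> P (u + v)"
    and "\<And>a v. v \<in> hpart V a \<Longrightarrow> P v"
  shows "P v"
  using assms component_sum component_in component_in_carrier by metis

lemma twist_homogeneous: "v \<in> hpart V b \<Longrightarrow> twist V a v = scale V (parity_sign (a * b)) v"
  unfolding twist_def sum_bit by (cases b) (simp_all add: component_homogeneous)

lemma twist_0 [simp]: "v \<in> carrier_of V \<Longrightarrow> twist V 0 v = v"
  unfolding twist_def sum_bit by (simp add: component_sum)

lemma twist_hpart: "v \<in> hpart V b \<Longrightarrow> twist V a v \<in> hpart V b"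
  by (simp add: twist_homogeneous hpart_scale)

lemma twist_in_carrier: "v \<in> carrier_of V \<Longrightarrow> twist V a v \<in> carrier_of V"
  unfolding twist_def sum_bit by (intro carrier_add carrier_scale component_in_carrier)

lemma twist_zero [simp]: "twist V a 0 = 0"
  unfolding twist_def sum_bit by simp

lemma twist_add:
  "u \<in> carrier_of V \<Longrightarrow> v \<in> carrier_of V \<Longrightarrow> twist V a (u + v) = twist V a u + twist V a v"
  unfolding twist_def sum_bit by (simp add: component_add scale_right_distrib)

lemma twist_scale:
  "v \<in> carrier_of V \<Longrightarrow> twist V a (scale V c v) = scale V c (twist V a v)"
  unfolding twist_def sum_bit by (simp add: component_scale scale_right_distrib mult.commute)

lemma twist_neg: "v \<in> carrier_of V \<Longrightarrow> twist V a (- v) = - twist V a v"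
  using twist_scale[of v a "-1"] by simp

lemma component_twist:
  "v \<in> carrier_of V \<Longrightarrow> component V b (twist V a v) = scale V (parity_sign (a * b)) (component V b v)"
  unfolding twist_def sum_bit
  by (cases b)
    (simp_all add: component_add component_in_carrier carrier_scale component_scale
      component_homogeneous[OF component_in])

lemma twist_component:
  "v \<in> carrier_of V \<Longrightarrow> twist V a (component V b v) = component V b (twist V a v)"
  by (simp add: component_twist twist_homogeneous[OF component_in])

lemma twist_twist: "v \<in> carrier_of V \<Longrightarrow> twist V a (twist V b v) = twist V (a + b) v"
proof (induction rule: carrier_induct)
  case (add u v)
  then show ?case by (simp add: twist_add twist_in_carrier)
next
  case (homogeneous c v)
  then show ?case
    by (simp add: twist_homogeneous twist_scale hpart_carrier distrib_right parity_sign_add)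
qed

lemma twist_self [simp]: "v \<in> carrier_of V \<Longrightarrow> twist V a (twist V a v) = v"
  by (simp add: twist_twist)

end


section \<open>Linear maps on the carriers of superspaces\<close>

lemma linear_mapD:
  assumes "linear_map V W f"
  shows "v \<in> carrier_of V \<Longrightarrow> f v \<in> carrier_of W"
    and "u \<in> carrier_of V \<Longrightarrow> v \<in> carrier_of V \<Longrightarrow> f (u + v) = f u + f v"
    and "v \<in> carrier_of V \<Longrightarrow> f (scale V c v) = scale W c (f v)"
  using assms unfolding linear_map_def by auto

lemma linear_map_more:
  assumes "superspace V" "superspace W" "linear_map V W f"
  shows "f 0 = 0"
    and "v \<in> carrier_of V \<Longrightarrow> f (- v) = - f v"
    and "u \<in> carrier_of V \<Longrightarrow> v \<in> carrier_of V \<Longrightarrow> f (u - v) = f u - f v"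
proof -
  interpret V: superspace V by fact
  interpret W: superspace W by fact
  show "f 0 = 0" using linear_mapD(3)[OF assms(3) V.carrier_zero, of 0] by simp
  show neg: "f (- v) = - f v" if "v \<in> carrier_of V" for v
    using linear_mapD(3)[OF assms(3) that, of "- 1"] by simp
  show "f (u - v) = f u - f v" if "u \<in> carrier_of V" "v \<in> carrier_of V"
    using linear_mapD(2)[OF assms(3) that(1) V.carrier_neg[OF that(2)]] neg[OF that(2)] by simp
qed

lemma linear_map_comp:
  "linear_map U V f \<Longrightarrow> linear_map V W g \<Longrightarrow> linear_map U W (\<lambda>u. g (f u))"
  unfolding linear_map_def by simp

lemma (in superspace) linear_map_component: "linear_map V V (component V a)"
  unfolding linear_map_def by (simp add: component_in_carrier component_add component_scale)

lemma (in superspace) linear_map_twist: "linear_map V V (twist V a)"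
  unfolding linear_map_def by (simp add: twist_in_carrier twist_add twist_scale)

lemma (in superspace) linear_map_plus:
  "linear_map U V f \<Longrightarrow> linear_map U V g \<Longrightarrow> linear_map U V (\<lambda>u. f u + g u)"
  unfolding linear_map_def by (simp add: carrier_add scale_right_distrib)

lemma (in superspace) linear_map_diff:
  "linear_map U V f \<Longrightarrow> linear_map U V g \<Longrightarrow> linear_map U V (\<lambda>u. f u - g u)"
  unfolding linear_map_def by (simp add: carrier_diff scale_right_diff_distrib)

lemma (in superspace) linear_map_scale:
  "linear_map U V f \<Longrightarrow> linear_map U V (\<lambda>u. scale V c (f u))"
  unfolding linear_map_def by (simp add: carrier_scale scale_right_distrib mult.commute)

lemma (in superspace) linear_map_0: "linear_map U V (\<lambda>u. 0)"
  unfolding linear_map_def by simp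


section \<open>The star action\<close>

text \<open>Linearity and evenness of the action are separated from its compatibility with bracket
  and p-map. The calculus of \<open>star\<close>, cocycles and coboundaries is developed at this
  level, and \<open>Hom_module L N M\<close> enters in this form.\<close>

locale graded_action = superspace V + L: lie_superalgebra L
  for L :: "('f::field, 'l::ab_group_add, 'x) lie_superalgebra_scheme"
  and V :: "('f, 'l, 'v::ab_group_add, 'y) lmodule_scheme" +
  assumes linear_right: "\<And>x. linear_map V V (act V x)"
    and linear_left: "\<And>v. v \<in> carrier_of V \<Longrightarrow> linear_map L V (\<lambda>x. act V x v)"
    and even_action: "\<And>a b x v. x \<in> hpart L a \<Longrightarrow> v \<in> hpart V b \<Longrightarrow> act V x v \<in> hpart V (a + b)"

definition star ::
  "('f::field, 'l::ab_group_add, 'x) lie_superalgebra_scheme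
    \<Rightarrow> ('f, 'l, 'v::ab_group_add, 'y) lmodule_scheme \<Rightarrow> 'l \<Rightarrow> 'v \<Rightarrow> 'v" where
  "star L V x v = (\<Sum>a\<in>{0, 1}. act V (component L a x) (twist V a v))"

context lie_superalgebra
begin

lemma in_carrier [simp]: "x \<in> carrier_of L"
  by (simp add: carrier_UNIV)

end

context graded_action
begin

lemmas act_carrier = linear_mapD(1)[OF linear_right]
lemmas act_add = linear_mapD(2)[OF linear_right]
lemmas act_scale = linear_mapD(3)[OF linear_right]
lemmas act_zero [simp] = linear_map_more(1)[OF superspace_axioms superspace_axioms linear_right]
lemmas act_neg = linear_map_more(2)[OF superspace_axioms superspace_axioms linear_right]
lemmas act_diff = linear_map_more(3)[OF superspace_axioms superspace_axioms linear_right]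

lemma act_add_left: "v \<in> carrier_of V \<Longrightarrow> act V (x + y) v = act V x v + act V y v"
  using linear_mapD(2)[OF linear_left] by simp

lemma act_scale_left: "v \<in> carrier_of V \<Longrightarrow> act V (scale L c x) v = scale V c (act V x v)"
  using linear_mapD(3)[OF linear_left] by simp

lemma act_zero_left [simp]: "v \<in> carrier_of V \<Longrightarrow> act V 0 v = 0"
  using linear_map_more(1)[OF L.superspace_axioms superspace_axioms linear_left] .

lemma act_component:
  assumes "x \<in> hpart L a" "v \<in> carrier_of V"
  shows "component V b (act V x v) = act V x (component V (a + b) v)"
  using assms(2)
proof (induction rule: carrier_induct)
  case (add u v)
  then show ?case by (simp add: act_add component_add act_carrier component_in_carrier)
next
  case (homogeneous c v)
  have "act V x v \<in> hpart V (a + c)" using even_action[OF assms(1) homogeneous] .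
  then show ?case using homogeneous
    by (cases a; cases b; cases c) (simp_all add: component_homogeneous)
qed

text \<open>Since \<open>x\<close> shifts parities by b, moving \<delta>^a past \<open>x\<close>
  costs the sign (-1)^(ab).\<close>

lemma act_twist:
  assumes "x \<in> hpart L b" "v \<in> carrier_of V"
  shows "act V x (twist V a v) = scale V (parity_sign (a * b)) (twist V a (act V x v))"
  using assms(2)
proof (induction rule: carrier_induct)
  case (add u v)
  then show ?case
    by (simp add: act_add twist_add act_carrier twist_in_carrier scale_right_distrib)
next
  case (homogeneous c v)
  have "act V x v \<in> hpart V (b + c)" using even_action[OF assms(1) homogeneous] .
  then show ?case using homogeneous
    by (cases a; cases b; cases c) (simp_all add: twist_homogeneous act_neg hpart_carrier)
qed

lemma twist_act:
  assumes "x \<in> hpart L b" "v \<in> carrier_of V"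
  shows "twist V a (act V x v) = scale V (parity_sign (a * b)) (act V x (twist V a v))"
  using act_twist[OF assms, of a] by simp

lemma star_homogeneous:
  "x \<in> hpart L a \<Longrightarrow> v \<in> carrier_of V \<Longrightarrow> star L V x v = act V x (twist V a v)"
  unfolding star_def sum_bit by (cases a) (simp_all add: L.component_homogeneous twist_in_carrier)

lemma linear_map_star: "linear_map V V (star L V x)"
  unfolding star_def sum_bit
  by (intro linear_map_plus linear_map_comp[OF linear_map_twist linear_right])

lemma linear_map_star_left: "v \<in> carrier_of V \<Longrightarrow> linear_map L V (\<lambda>x. star L V x v)"
  unfolding star_def sum_bit
  by (intro linear_map_plus linear_map_comp[OF L.linear_map_component linear_left] twist_in_carrier)

lemmas star_carrier = linear_mapD(1)[OF linear_map_star]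
lemmas star_add = linear_mapD(2)[OF linear_map_star]
lemmas star_scale = linear_mapD(3)[OF linear_map_star]
lemmas star_zero [simp] = linear_map_more(1)[OF superspace_axioms superspace_axioms linear_map_star]
lemmas star_diff = linear_map_more(3)[OF superspace_axioms superspace_axioms linear_map_star]

lemma star_add_left: "v \<in> carrier_of V \<Longrightarrow> star L V (x + y) v = star L V x v + star L V y v"
  using linear_mapD(2)[OF linear_map_star_left] by simp

text \<open>\<delta> preserves parities, so \<open>star\<close> shifts them exactly as
  \<open>act\<close> does. Later this splits cocycle identities into homogeneous parts.\<close>

lemma star_component:
  assumes "x \<in> hpart L a" "v \<in> carrier_of V"
  shows "component V b (star L V x v) = star L V x (component V (a + b) v)"
  using assms
  by (simp add: star_homogeneous act_component twist_in_carrier component_in_carrier twist_component)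

end

context restricted_module
begin

lemma graded_actionI: "lie_superalgebra L \<Longrightarrow> graded_action L V"
  by (simp add: graded_action_def graded_action_axioms_def superspace_axioms
      linear_act_right linear_act_left act_even)

end


section \<open>Homomorphisms\<close>

definition hom_component ::
  "('f::field, 'v::ab_group_add, 'x) superspace_scheme \<Rightarrow> ('f, 'w::ab_group_add, 'y) superspace_scheme
    \<Rightarrow> bit \<Rightarrow> ('v \<Rightarrow> 'w) \<Rightarrow> 'v \<Rightarrow> 'w" where
  "hom_component V W k f v = (\<Sum>b\<in>{0, 1}. component W (k + b) (f (component V b v)))"

lemma linear_map_hom_component:
  assumes "superspace V" "superspace W" "linear_map V W f"
  shows "linear_map V W (hom_component V W k f)"
proof -
  interpret V: superspace V by fact
  interpret W: superspace W by fact
  show ?thesis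
    unfolding hom_component_def sum_bit
    by (intro W.linear_map_plus linear_map_comp[OF linear_map_comp[OF V.linear_map_component assms(3)]
        W.linear_map_component])
qed

lemma hom_component_homogeneous:
  assumes "superspace V" "superspace W" "linear_map V W f" "v \<in> hpart V b"
  shows "hom_component V W k f v = component W (k + b) (f v)"
proof -
  interpret V: superspace V by fact
  interpret W: superspace W by fact
  show ?thesis
    unfolding hom_component_def sum_bit using assms(4)
    by (cases b) (simp_all add: V.component_homogeneous linear_map_more(1)[OF assms(1-3)])
qed

lemma hom_component_hpart:
  assumes "superspace V" "superspace W" "linear_map V W f" "v \<in> hpart V b"
  shows "hom_component V W k f v \<in> hpart W (k + b)"
  unfolding hom_component_homogeneous[OF assms]
  by (intro superspace.component_in[OF assms(2)] linear_mapD(1)[OF assms(3)]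
      superspace.hpart_carrier[OF assms(1,4)])

lemma hom_component_sum:
  assumes "superspace V" "superspace W" "linear_map V W f" "v \<in> carrier_of V"
  shows "hom_component V W 0 f v + hom_component V W 1 f v = f v"
proof -
  interpret V: superspace V by fact
  interpret W: superspace W by fact
  have "component W b (f v) = component W b (f (component V 0 v)) + component W b (f (component V 1 v))" for b
    using W.component_add linear_mapD[OF assms(3)] V.component_in_carrier[OF assms(4)]
      V.component_sum[OF assms(4)] by metis
  then show ?thesis
    using W.component_sum[OF linear_mapD(1)[OF assms(3,4)]]
    unfolding hom_component_def sum_bit by (simp add: algebra_simps)
qed

text \<open>A homomorphism f of parity k satisfies f x = (-1)^(k|x|) x f, and likewise f \<delta>^a
  = (-1)^(ka) \<delta>^a f. In x \<delta>^|x| the two signs cancel.\<close>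

lemma homogeneous_hom_star:
  assumes "graded_action L V" "graded_action L W" "f \<in> homogeneous_hom L V W k" "v \<in> carrier_of V"
  shows "f (star L V x v) = star L W x (f v)"
proof -
  interpret V: graded_action L V by fact
  interpret W: graded_action L W by fact
  have f: "linear_map V W f" "\<And>b v. v \<in> hpart V b \<Longrightarrow> f v \<in> hpart W (k + b)"
    "\<And>a x v. x \<in> hpart L a \<Longrightarrow> v \<in> carrier_of V \<Longrightarrow>
      f (act V x v) = scale W (parity_sign (k * a)) (act W x (f v))"
    using assms(3) unfolding homogeneous_hom_def by auto
  note fl = linear_mapD[OF f(1)] linear_map_more[OF V.superspace_axioms W.superspace_axioms f(1)]
  have hom: "f (star L V x v) = star L W x (f v)" if "x \<in> hpart L a" for a x
    using assms(4)
  proof (induction rule: V.carrier_induct)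
    case (add u v)
    then show ?case by (simp add: V.star_add W.star_add fl V.star_carrier)
  next
    case (homogeneous b v)
    have fv: "f v \<in> hpart W (k + b)" using f(2)[OF homogeneous] .
    have "f (star L V x v) = scale W (parity_sign (k * a)) (act W x (f (twist V a v)))"
      using homogeneous that by (simp add: V.star_homogeneous V.hpart_carrier f(3) V.twist_in_carrier)
    also have "\<dots> = act W x (twist W a (f v))"
      using homogeneous fv
      by (cases a; cases b; cases k)
        (simp_all add: V.twist_homogeneous W.twist_homogeneous fl V.hpart_carrier W.act_neg W.hpart_carrier)
    finally show ?case
      using that fv by (simp add: W.star_homogeneous W.hpart_carrier)
  qed
  show ?thesis
    using V.L.in_carrier[of x]
  proof (induction rule: V.L.carrier_induct)
    case (add x y)
    then show ?case
      by (simp add: V.star_add_left W.star_add_left assms(4) fl V.star_carrier)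
  qed (rule hom)
qed

text \<open>Removes the parities of homomorphisms from the later arguments. For the converse,
  projecting the commutation relation with \<open>star\<close> to a fixed parity shows that each
  homogeneous component of f is itself a homomorphism.\<close>

lemma lmodule_hom_iff:
  assumes "graded_action L V" "graded_action L W"
  shows "f \<in> lmodule_hom L V W \<longleftrightarrow>
    linear_map V W f \<and> (\<forall>x. \<forall>v\<in>carrier_of V. f (star L V x v) = star L W x (f v))"
proof -
  interpret V: graded_action L V by fact
  interpret W: graded_action L W by fact
  note ss = V.superspace_axioms W.superspace_axioms
  show ?thesis
  proof (intro iffI conjI)
    assume "f \<in> lmodule_hom L V W"
    then obtain f0 f1 where f: "f0 \<in> homogeneous_hom L V W 0" "f1 \<in> homogeneous_hom L V W 1"
      "\<And>v. v \<in> carrier_of V \<Longrightarrow> f v = f0 v + f1 v" unfolding lmodule_hom_def by blast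
    have lin: "linear_map V W f0" "linear_map V W f1"
      using f unfolding homogeneous_hom_def by auto
    show "linear_map V W f"
      using W.linear_map_plus[OF lin] f(3) unfolding linear_map_def
      by (simp add: V.carrier_add V.carrier_scale)
    show "\<forall>x. \<forall>v\<in>carrier_of V. f (star L V x v) = star L W x (f v)"
      using homogeneous_hom_star[OF assms f(1)] homogeneous_hom_star[OF assms f(2)]
      by (simp add: f(3) V.star_carrier W.star_add linear_mapD(1)[OF lin(1)] linear_mapD(1)[OF lin(2)])
  next
    assume R: "linear_map V W f \<and> (\<forall>x. \<forall>v\<in>carrier_of V. f (star L V x v) = star L W x (f v))"
    then have lin: "linear_map V W f" and st: "\<And>x v. v \<in> carrier_of V \<Longrightarrow> f (star L V x v) = star L W x (f v)"
      by auto
    note fl = linear_mapD[OF lin] linear_map_more[OF ss lin]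
    have "hom_component V W k f \<in> homogeneous_hom L V W k" for k
    proof -
      let ?g = "hom_component V W k f"
      have gl: "linear_map V W ?g" by (rule linear_map_hom_component[OF ss lin])
      note gg = linear_mapD[OF gl] linear_map_more[OF ss gl]
      have "?g (act V x v) = scale W (parity_sign (k * a)) (act W x (?g v))"
        if x: "x \<in> hpart L a" and "v \<in> carrier_of V" for a x v
        using that(2)
      proof (induction rule: V.carrier_induct)
        case (add u v)
        then show ?case
          by (simp add: V.act_add V.act_carrier W.act_add gg W.scale_right_distrib)
      next
        case (homogeneous b v)
        have cv: "v \<in> carrier_of V" using homogeneous V.hpart_carrier by blast
        have "?g (act V x v) = component W (k + (a + b)) (f (act V x v))"
          by (rule hom_component_homogeneous[OF ss lin V.even_action[OF x homogeneous]])
        \<comment> \<open>Writing xv as x * \<delta>^a v makes the hypothesis on \<open>star\<close>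
          applicable.\<close>
        also have "f (act V x v) = f (star L V x (twist V a v))"
          using x cv by (simp add: V.star_homogeneous V.twist_in_carrier)
        also have "component W (k + (a + b)) (f (star L V x (twist V a v)))
          = act W x (component W (k + b) (twist W a (f (twist V a v))))"
          using x cv V.twist_in_carrier W.star_homogeneous W.act_component W.twist_in_carrier fl(1) st
          by (simp add: add.left_commute)
        also have "component W (k + b) (twist W a (f (twist V a v)))
          = scale W (parity_sign (k * a)) (component W (k + b) (f v))"
          using homogeneous cv
          by (cases a; cases b; cases k)
            (simp_all add: V.twist_homogeneous W.component_twist W.twist_neg fl W.component_neg W.twist_in_carrier)
        also have "component W (k + b) (f v) = ?g v"
          by (rule hom_component_homogeneous[OF ss lin homogeneous, symmetric])
        finally show ?case using gg(1)[OF cv] by (simp add: W.act_scale)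
      qed
      then show ?thesis
        unfolding homogeneous_hom_def using gl hom_component_hpart[OF ss lin] by auto
    qed
    then show "f \<in> lmodule_hom L V W"
      unfolding lmodule_hom_def mem_Collect_eq using hom_component_sum[OF ss lin, symmetric]
      by (intro bexI[where x = "hom_component V W 0 f"] bexI[where x = "hom_component V W 1 f"] ballI)
  qed
qed


section \<open>Spaces of linear maps\<close>

lemma Hom_space_simps [simp]:
  "scale (Hom_space V W) c f = (\<lambda>v. scale W c (f v))"
  "f \<in> hpart (Hom_space V W) k \<longleftrightarrow> linear_map V W f \<and> (\<forall>b. \<forall>v\<in>hpart V b. f v \<in> hpart W (k + b))"
  by (simp_all add: Hom_space_def)

locale superspace_pair = V: superspace V + W: superspace W
  for V :: "('f::field, 'v::ab_group_add, 'x) superspace_scheme"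
  and W :: "('f, 'w::ab_group_add, 'y) superspace_scheme" +
  assumes V_UNIV: "carrier_of V = UNIV"
begin

lemmas pair = V.superspace_axioms W.superspace_axioms
lemmas hom_component_linear = linear_map_hom_component[OF pair]
lemmas hom_component_eq = hom_component_homogeneous[OF pair]
lemmas hom_component_in = hom_component_hpart[OF pair]
lemmas hom_component_total = hom_component_sum[OF pair]

lemma V_carrier [simp]: "v \<in> carrier_of V"
  by (simp add: V_UNIV)

text \<open>A map that is both even and odd sends a homogeneous vector into both parts of
  \<open>W\<close>, hence to 0. As V fills its type and is spanned by homogeneous vectors, the map
  is 0.\<close>

lemma superspace_Hom: "superspace (Hom_space V W)"
proof -
  interpret H: vector_space "scale (Hom_space V W)"
    by unfold_locales
      (simp_all add: fun_eq_iff W.scale_right_distrib W.scale_left_distrib)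
  show ?thesis
  proof
    fix k
    show "H.subspace (hpart (Hom_space V W) k)"
    proof (rule H.subspaceI)
      show "0 \<in> hpart (Hom_space V W) k"
        using W.linear_map_0 by (simp add: zero_fun_def)
      show "f + g \<in> hpart (Hom_space V W) k"
        if "f \<in> hpart (Hom_space V W) k" "g \<in> hpart (Hom_space V W) k" for f g
        using that W.linear_map_plus[of V f g] by (simp add: plus_fun_def W.hpart_add)
      show "scale (Hom_space V W) c f \<in> hpart (Hom_space V W) k"
        if "f \<in> hpart (Hom_space V W) k" for f c
        using that W.linear_map_scale[of V f c] by (simp add: W.hpart_scale)
    qed
  next
    have "f v = 0" if f: "f \<in> hpart (Hom_space V W) 0" "f \<in> hpart (Hom_space V W) 1" for f v
      using V_carrier[of v]
    proof (induction rule: V.carrier_induct)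
      case (add u v)
      then show ?case using f linear_mapD(2)[of V W f u v] by simp
    next
      case (homogeneous b v)
      then have "f v \<in> hpart W (0 + b)" "f v \<in> hpart W (1 + b)"
        using f by (simp_all only: Hom_space_simps)
      then show ?case using W.hparts_disjoint[of "f v" "0 + b" "1 + b"] by simp
    qed
    moreover have "0 \<in> hpart (Hom_space V W) k" for k
      using W.linear_map_0 by (simp add: zero_fun_def)
    ultimately show "hpart (Hom_space V W) 0 \<inter> hpart (Hom_space V W) 1 = {0}"
      by (auto simp del: Hom_space_simps simp: fun_eq_iff)
  qed
qed

sublocale H: superspace "Hom_space V W"
  by (rule superspace_Hom)

lemma hom_component_in_Hom: "linear_map V W f \<Longrightarrow> hom_component V W k f \<in> hpart (Hom_space V W) k"
  by (simp add: hom_component_linear hom_component_in)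

lemma carrier_Hom: "carrier_of (Hom_space V W) = {f. linear_map V W f}"
proof (intro set_eqI iffI)
  fix f assume "f \<in> carrier_of (Hom_space V W)"
  then show "f \<in> {f. linear_map V W f}"
    unfolding carrier_of_def using W.linear_map_plus by (auto simp: plus_fun_def)
next
  fix f assume "f \<in> {f. linear_map V W f}"
  then have "linear_map V W f" by simp
  then show "f \<in> carrier_of (Hom_space V W)"
    using H.carrier_add[OF H.hpart_carrier H.hpart_carrier, OF hom_component_in_Hom hom_component_in_Hom, of f f 0 1]
    by (simp add: plus_fun_def hom_component_total)
qed

lemma component_Hom:
  assumes "linear_map V W f"
  shows "component (Hom_space V W) k f = hom_component V W k f"
proof (rule H.component_unique)
  show "hom_component V W k f \<in> hpart (Hom_space V W) k"
    by (rule hom_component_in_Hom[OF assms])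
  have "f - hom_component V W k f = hom_component V W (k + 1) f"
    using hom_component_total[OF assms] by (cases k) (auto simp: fun_eq_iff algebra_simps)
  then show "f - hom_component V W k f \<in> hpart (Hom_space V W) (k + 1)"
    using hom_component_in_Hom[OF assms] by simp
qed

text \<open>The parity operator on linear maps is conjugation by \<delta>, which has eigenvalue
  (-1)^k on maps of parity k.\<close>

lemma twist_Hom:
  assumes "linear_map V W f"
  shows "twist (Hom_space V W) a f v = twist W a (f (twist V a v))"
  using V_carrier[of v]
proof (induction rule: V.carrier_induct)
  note fl = linear_mapD[OF assms]
  case (add u v)
  have "linear_map V W (twist (Hom_space V W) a f)"
    using H.twist_in_carrier[of f a] assms by (simp add: carrier_Hom)
  with add show ?case by (simp add: linear_mapD(2) V.twist_add fl W.twist_add)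
next
  note fl = linear_mapD[OF assms]
  case (homogeneous b v)
  have "twist W a (f (twist V a v)) = scale W (parity_sign (a * b)) (twist W a (f v))"
    using homogeneous by (simp add: V.twist_homogeneous fl W.twist_scale)
  then show ?case
    using homogeneous
    unfolding twist_def sum_bit component_Hom[OF assms]
    by (cases a; cases b) (simp_all add: hom_component_eq[OF assms])
qed

end


section \<open>Linear maps between two modules\<close>

locale action_pair = N: graded_action L N + M: graded_action L M
  for L :: "('f::field, 'l::ab_group_add, 'x) lie_superalgebra_scheme"
  and N :: "('f, 'l, 'n::ab_group_add, 'y) lmodule_scheme"
  and M :: "('f, 'l, 'm::ab_group_add, 'z) lmodule_scheme" +
  assumes N_UNIV: "carrier_of N = UNIV"
    and M_UNIV: "carrier_of M = UNIV"
begin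

lemma M_carrier [simp]: "m \<in> carrier_of M"
  by (simp add: M_UNIV)

sublocale NM: superspace_pair N M
  by unfold_locales (rule N_UNIV)

lemma Hom_module_simps [simp]:
  "scale (Hom_module L N M) = scale (Hom_space N M)"
  "hpart (Hom_module L N M) = hpart (Hom_space N M)"
  by (simp_all add: Hom_module_def)

lemma Hom_module_eqs:
  "carrier_of (Hom_module L N M) = {f. linear_map N M f}"
  "component (Hom_module L N M) = component (Hom_space N M)"
  "twist (Hom_module L N M) = twist (Hom_space N M)"
  unfolding NM.carrier_Hom[symmetric] carrier_of_def component_def[abs_def] twist_def[abs_def]
    Hom_module_simps
  by (rule refl)+

lemma superspace_Hom_module: "superspace (Hom_module L N M)"
  using NM.superspace_Hom unfolding superspace_def superspace_axioms_def Hom_module_simps .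

text \<open>Summing over the homogeneous components of f turns the sign (-1)^(|f||x|) into
  conjugation of f by \<delta>^|x|, so that the parity of f no longer occurs.\<close>

lemma act_Hom:
  assumes f: "linear_map N M f"
  shows "act (Hom_module L N M) x f n = (\<Sum>a\<in>{0, 1}. act M (component L a x) (f n)
    - twist M a (f (twist N a (act N (component L a x) n))))"
proof -
  have "(\<Sum>k\<in>{0, 1}. act M y (component (Hom_space N M) k f n)
        - scale M (parity_sign (k * a)) (component (Hom_space N M) k f (act N y n)))
    = act M y (f n) - twist M a (f (twist N a (act N y n)))" for y a
  proof -
    have "act M y (f n) = act M y (component (Hom_space N M) 0 f n) + act M y (component (Hom_space N M) 1 f n)"
      by (simp add: NM.component_Hom[OF f] NM.hom_component_total[OF f] flip: M.act_add)
    moreover have "twist M a (f (twist N a (act N y n))) =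
      scale M (parity_sign (a * 0)) (component (Hom_space N M) 0 f (act N y n)) +
      scale M (parity_sign (a * 1)) (component (Hom_space N M) 1 f (act N y n))"
      unfolding NM.twist_Hom[OF f, symmetric] by (simp only: twist_def[of "Hom_space N M"] sum_bit plus_fun_def Hom_space_simps)
    ultimately show ?thesis by (simp add: algebra_simps)
  qed
  then show ?thesis by (simp only: Hom_module_def lmodule.select_convs)
qed

lemma act_Hom_homogeneous:
  assumes f: "linear_map N M f" and x: "x \<in> hpart L a"
  shows "act (Hom_module L N M) x f n = act M x (f n) - twist M a (f (twist N a (act N x n)))"
  unfolding act_Hom[OF f] sum_bit
  using x linear_map_more(1)[OF NM.pair f]
  by (cases a) (simp_all add: N.L.component_homogeneous)

lemma linear_act_Hom:
  assumes f: "linear_map N M f"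
  shows "linear_map N M (act (Hom_module L N M) x f)"
  unfolding act_Hom[OF f] sum_bit
  by (intro M.linear_map_plus M.linear_map_diff linear_map_comp[OF f M.linear_right]
      linear_map_comp[OF N.linear_right] linear_map_comp[OF N.linear_map_twist]
      linear_map_comp[OF f M.linear_map_twist])

lemma linear_map_fun_add: "linear_map N M f \<Longrightarrow> linear_map N M g \<Longrightarrow> linear_map N M (f + g)"
  using M.linear_map_plus[of N f g] by (simp add: plus_fun_def)

lemma graded_action_Hom: "graded_action L (Hom_module L N M)"
proof -
  interpret H: superspace "Hom_module L N M"
    by (rule superspace_Hom_module)
  show ?thesis
  proof
    show "linear_map (Hom_module L N M) (Hom_module L N M) (act (Hom_module L N M) x)" for x
      unfolding linear_map_def
      by (auto simp: Hom_module_eqs linear_act_Hom fun_eq_iff act_Hom linear_map_fun_add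
          M.linear_map_scale M.act_add M.twist_add M.act_scale M.twist_scale
          M.scale_right_distrib M.scale_right_diff_distrib algebra_simps)
  next
    fix f assume "f \<in> carrier_of (Hom_module L N M)"
    then have f: "linear_map N M f" by (simp add: Hom_module_eqs)
    show "linear_map L (Hom_module L N M) (\<lambda>x. act (Hom_module L N M) x f)"
      unfolding linear_map_def
      by (auto simp: Hom_module_eqs linear_act_Hom f fun_eq_iff act_Hom N.L.component_add
          N.L.component_scale M.act_add_left N.act_add_left M.act_scale_left N.act_scale_left
          N.twist_add N.twist_scale linear_mapD[OF f] M.twist_add M.twist_scale
          M.scale_right_distrib M.scale_right_diff_distrib algebra_simps)
  next
    fix a b x f assume x: "x \<in> hpart L a" and f: "f \<in> hpart (Hom_module L N M) b"
    then have fl: "linear_map N M f" and fe: "\<And>c n. n \<in> hpart N c \<Longrightarrow> f n \<in> hpart M (b + c)"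
      by auto
    have "act (Hom_module L N M) x f n \<in> hpart M (a + b + c)" if n: "n \<in> hpart N c" for n c
    proof -
      have "act M x (f n) \<in> hpart M (a + (b + c))"
        by (rule M.even_action[OF x fe[OF n]])
      moreover have "f (twist N a (act N x n)) \<in> hpart M (b + (a + c))"
        by (intro fe N.twist_hpart N.even_action[OF x n])
      ultimately show ?thesis
        by (simp add: act_Hom_homogeneous[OF fl x] M.hpart_diff M.twist_hpart algebra_simps)
    qed
    then show "act (Hom_module L N M) x f \<in> hpart (Hom_module L N M) (a + b)"
      by (simp add: linear_act_Hom[OF fl])
  qed
qed

sublocale HM: graded_action L "Hom_module L N M"
  by (rule graded_action_Hom)

text \<open>Passing from \<open>act\<close> to \<open>star\<close> replaces f by \<delta>^a f
  \<delta>^a. In the second term of \<open>act_Hom_homogeneous\<close> this undoes the conjugation;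
  in the first, the left factor \<delta>^a turns the action on \<open>M\<close> into
  \<open>star\<close>.\<close>

lemma star_Hom:
  assumes f: "linear_map N M f" and x: "x \<in> hpart L a"
  shows "star L (Hom_module L N M) x f n = star L M x (f (twist N a n)) - f (act N x n)"
proof -
  have tf: "linear_map N M (twist (Hom_module L N M) a f)"
    using HM.twist_in_carrier[of f a] f by (simp add: Hom_module_eqs)
  have "star L (Hom_module L N M) x f n = act (Hom_module L N M) x (twist (Hom_module L N M) a f) n"
    using f x by (simp add: HM.star_homogeneous Hom_module_eqs)
  also have "\<dots> = star L M x (f (twist N a n)) - f (act N x n)"
    unfolding act_Hom_homogeneous[OF tf x]
    by (simp add: Hom_module_eqs NM.twist_Hom[OF f] M.star_homogeneous[OF x])
  finally show ?thesis .
qed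

end


section \<open>Cocycles and coboundaries\<close>

context graded_action
begin

sublocale LV: superspace_pair L V
  by unfold_locales (rule L.carrier_UNIV)

text \<open>The sign (-1)^(|x||v|) is the effect of \<delta>^|x| on v.\<close>

lemma d0_eq_star:
  assumes "v \<in> carrier_of V"
  shows "d0 L V v x = star L V x v"
  using assms component_in_carrier[OF assms]
  unfolding d0_def star_def twist_def sum_bit
  by (simp add: act_add act_diff)

lemma B1_iff: "\<phi> \<in> B1 L V \<longleftrightarrow> (\<exists>v\<in>carrier_of V. \<phi> = (\<lambda>x. star L V x v))"
  unfolding B1_def by (auto simp: d0_eq_star fun_eq_iff intro!: image_eqI)

text \<open>The vector \<phi>_k(y) has parity k + b, and (-1)^(ak) = (-1)^(ab) (-1)^(a(k+b)), where
  the last factor is the effect of \<delta>^a on it; similarly (-1)^(b(a+k)) is the effect of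
  \<delta>^b on \<phi>_k(x). Summing over k leaves only \<open>star\<close> and \<phi>
  itself.\<close>

lemma d1_eq:
  assumes \<phi>: "linear_map L V \<phi>"
  shows "d1 L V \<phi> x y = (\<Sum>a\<in>{0, 1}. \<Sum>b\<in>{0, 1}.
    scale V (parity_sign (a * b)) (star L V (component L a x) (\<phi> (component L b y)))
    - star L V (component L b y) (\<phi> (component L a x))
    - \<phi> (bracket L (component L a x) (component L b y)))"
proof -
  have "(\<Sum>k\<in>{0, 1}. let \<phi>k = component (Hom_space L V) k \<phi> in
       - \<phi>k (bracket L u w) + scale V (parity_sign (a * k)) (act V u (\<phi>k w))
       - scale V (parity_sign (b * (a + k))) (act V w (\<phi>k u)))
    = scale V (parity_sign (a * b)) (star L V u (\<phi> w)) - star L V w (\<phi> u) - \<phi> (bracket L u w)"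
    if u: "u \<in> hpart L a" and w: "w \<in> hpart L b" for a b u w
  proof -
    define f where "f k = component (Hom_space L V) k \<phi>" for k
    have fc: "f k z \<in> carrier_of V" for k z
      using linear_mapD(1)[OF LV.hom_component_linear[OF \<phi>]]
      by (simp add: f_def LV.component_Hom[OF \<phi>])
    have sum_f: "f 0 z + f 1 z = \<phi> z" for z
      by (simp add: f_def LV.component_Hom[OF \<phi>] LV.hom_component_total[OF \<phi>])
    \<comment> \<open>Two evaluations of \<delta>^c \<phi> \<delta>^c at t: the conjugate of \<phi>
      is f_0 + (-1)^c f_1, and \<delta>^c t = (-1)^(cd) t.\<close>
    have tw: "scale V (parity_sign (c * d)) (act V s (twist V c (\<phi> t)))
      = act V s (f 0 t) + scale V (parity_sign c) (act V s (f 1 t))"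
      if "s \<in> hpart L c" "t \<in> hpart L d" for s t c d
    proof -
      have "twist V c (\<phi> (twist L c t)) = f 0 t + scale V (parity_sign c) (f 1 t)"
        unfolding LV.twist_Hom[OF \<phi>, symmetric]
        by (simp only: twist_def[of "Hom_space L V"] sum_bit plus_fun_def Hom_space_simps f_def)
          simp
      moreover have "twist V c (\<phi> (twist L c t)) = scale V (parity_sign (c * d)) (twist V c (\<phi> t))"
        using that linear_mapD[OF \<phi>] by (simp add: L.twist_homogeneous twist_scale)
      ultimately show ?thesis
        using act_scale[of "twist V c (\<phi> t)" s "parity_sign (c * d)"] linear_mapD(1)[OF \<phi>]
        by (simp add: fc act_add act_scale carrier_scale twist_in_carrier)
    qed
    have "star L V u (\<phi> w) = act V u (twist V a (\<phi> w))" "star L V w (\<phi> u) = act V w (twist V b (\<phi> u))"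
      using u w linear_mapD(1)[OF \<phi>] by (simp_all add: star_homogeneous)
    moreover have "act V w (twist V b (\<phi> u)) = scale V (parity_sign (b * a)) (act V w (f 0 u))
        + scale V (parity_sign (b * (a + 1))) (act V w (f 1 u))"
      using arg_cong[OF tw[OF w u], of "scale V (parity_sign (b * a))"]
      by (simp add: scale_right_distrib distrib_left parity_sign_add)
    moreover have "\<phi> (bracket L u w) = f 0 (bracket L u w) + f 1 (bracket L u w)"
      by (simp only: sum_f)
    ultimately show ?thesis
      unfolding f_def[symmetric] Let_def sum_bit using tw[OF u w] by simp
  qed
  from this[OF L.component_in L.component_in] show ?thesis
    unfolding d1_def Let_def by simp
qed

lemma d1_homogeneous:
  assumes \<phi>: "linear_map L V \<phi>" and "x \<in> hpart L a" "y \<in> hpart L b"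
  shows "d1 L V \<phi> x y = scale V (parity_sign (a * b)) (star L V x (\<phi> y)) - star L V y (\<phi> x)
    - \<phi> (bracket L x y)"
proof -
  have "bracket L 0 z = 0" "bracket L z 0 = 0" for z
    using linear_map_more(1)[OF L.superspace_axioms L.superspace_axioms L.linear_bracket_left]
      linear_map_more(1)[OF L.superspace_axioms L.superspace_axioms L.linear_bracket_right] by auto
  moreover have "star L V 0 v = 0" if "v \<in> carrier_of V" for v
    using star_homogeneous[OF L.hpart_zero[of 0] that] that by simp
  moreover have "\<phi> 0 = 0"
    by (rule linear_map_more(1)[OF L.superspace_axioms superspace_axioms \<phi>])
  ultimately show ?thesis
    unfolding d1_eq[OF \<phi>] sum_bit using assms(2,3) linear_mapD(1)[OF \<phi>]
    by (cases a; cases b) (simp_all add: L.component_homogeneous)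
qed

text \<open>By linearity in x and y the cocycle condition may be tested on homogeneous elements; the
  parity of \<phi> does not enter.\<close>

lemma Z1_iff:
  "\<phi> \<in> Z1 L V \<longleftrightarrow> linear_map L V \<phi> \<and>
    (\<forall>a b. \<forall>x\<in>hpart L a. \<forall>y\<in>hpart L b. \<phi> (bracket L x y) =
      scale V (parity_sign (a * b)) (star L V x (\<phi> y)) - star L V y (\<phi> x)) \<and>
    (\<forall>z\<in>hpart L 0. \<phi> (pmap L z) = (act V z ^^ (CHAR('f) - 1)) (\<phi> z))"
proof (cases "linear_map L V \<phi>")
  case True
  have "(\<forall>x y. d1 L V \<phi> x y = 0) \<longleftrightarrow> (\<forall>a b. \<forall>x\<in>hpart L a. \<forall>y\<in>hpart L b. \<phi> (bracket L x y) =
      scale V (parity_sign (a * b)) (star L V x (\<phi> y)) - star L V y (\<phi> x))"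
  proof (intro iffI allI ballI)
    fix a b x y assume "\<forall>x y. d1 L V \<phi> x y = 0" "x \<in> hpart L a" "y \<in> hpart L b"
    then show "\<phi> (bracket L x y) = scale V (parity_sign (a * b)) (star L V x (\<phi> y)) - star L V y (\<phi> x)"
      using d1_homogeneous[OF True, of x a y b] by simp
  next
    fix x y assume R: "\<forall>a b. \<forall>x\<in>hpart L a. \<forall>y\<in>hpart L b. \<phi> (bracket L x y) =
      scale V (parity_sign (a * b)) (star L V x (\<phi> y)) - star L V y (\<phi> x)"
    show "d1 L V \<phi> x y = 0"
      unfolding d1_eq[OF True]
      by (intro sum.neutral ballI) (simp add: R[rule_format, OF L.component_in L.component_in])
  qed
  then show ?thesis
    unfolding Z1_def ind1_def LV.carrier_Hom using True by simp
next
  case False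
  then show ?thesis unfolding Z1_def LV.carrier_Hom by simp
qed

lemma B1_zero: "0 \<in> B1 L V"
  unfolding B1_iff by (rule bexI[of _ 0]) (simp_all add: fun_eq_iff)

lemma B1_add: "\<phi> \<in> B1 L V \<Longrightarrow> \<psi> \<in> B1 L V \<Longrightarrow> \<phi> + \<psi> \<in> B1 L V"
  unfolding B1_iff
  by (elim bexE, rule_tac x = "v + va" in bexI) (simp_all add: fun_eq_iff star_add carrier_add)

lemma B1_scale: "\<phi> \<in> B1 L V \<Longrightarrow> (\<lambda>x. scale V c (\<phi> x)) \<in> B1 L V"
  unfolding B1_iff
  by (elim bexE, rule_tac x = "scale V c v" in bexI) (simp_all add: fun_eq_iff star_scale carrier_scale)

lemma B1_neg: "\<phi> \<in> B1 L V \<Longrightarrow> - \<phi> \<in> B1 L V"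
  using B1_scale[of \<phi> "- 1"] by (simp add: fun_Compl_def)

end

definition cohomologous ::
  "('f::field, 'l::ab_group_add, 'x) lie_superalgebra_scheme
    \<Rightarrow> ('f, 'l, 'v::ab_group_add, 'y) lmodule_scheme \<Rightarrow> ('l \<Rightarrow> 'v) rel" where
  "cohomologous L V = {(\<phi>, \<psi>). \<phi> \<in> Z1 L V \<and> \<psi> \<in> Z1 L V \<and> \<phi> - \<psi> \<in> B1 L V}"

lemma H1_eq: "H1 L V = Z1 L V // cohomologous L V"
  by (simp add: H1_def cohomologous_def)

lemma (in graded_action) equiv_cohomologous: "equiv (Z1 L V) (cohomologous L V)"
proof (rule equivI)
  show "cohomologous L V \<subseteq> Z1 L V \<times> Z1 L V"
    by (auto simp: cohomologous_def)
  show "refl_on (Z1 L V) (cohomologous L V)"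
    by (auto simp: refl_on_def cohomologous_def B1_zero)
  show "sym (cohomologous L V)"
    using B1_neg by (force simp: sym_def cohomologous_def)
  show "trans (cohomologous L V)"
    using B1_add by (force simp: trans_def cohomologous_def)
qed


text \<open>When \<open>R\<close> is the pullback of \<open>R'\<close> along \<open>f\<close>, the
  induced map on classes is injective. The target is the set of classes that \<open>f\<close> meets,
  because surjectivity onto \<open>B // R'\<close> is a separate matter.\<close>

lemma quotient_bij_betw:
  assumes R': "equiv B R'" and f: "\<And>x. x \<in> A \<Longrightarrow> f x \<in> B"
    and R: "R = {(x, y). x \<in> A \<and> y \<in> A \<and> (f x, f y) \<in> R'}"
  shows "bij_betw (\<lambda>X. R' `` (f ` X)) (A // R) ((\<lambda>x. R' `` {f x}) ` A)"
proof -
  have img: "R' `` (f ` (R `` {a})) = R' `` {f a}" if "a \<in> A" for a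
  proof -
    have "R' `` {f b} = R' `` {f a}" if "b \<in> R `` {a}" for b
      using that equiv_class_eq[OF R'] unfolding R by blast
    moreover have "a \<in> R `` {a}"
      using \<open>a \<in> A\<close> f equivE[OF R'] unfolding R by (auto dest: refl_onD)
    ultimately show ?thesis by blast
  qed
  have inj: "R `` {a} = R `` {b}" if "a \<in> A" "b \<in> A" "R' `` {f a} = R' `` {f b}" for a b
  proof -
    have "(f a, f c) \<in> R' \<longleftrightarrow> (f b, f c) \<in> R'" for c
      using that(3) by blast
    then show ?thesis using that(1,2) unfolding R by auto
  qed
  show ?thesis
    unfolding bij_betw_def
  proof
    show "inj_on (\<lambda>X. R' `` (f ` X)) (A // R)"
    proof (rule inj_onI)
      fix X Y assume "X \<in> A // R" "Y \<in> A // R" and eq: "R' `` (f ` X) = R' `` (f ` Y)"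
      then obtain a b where "a \<in> A" "X = R `` {a}" "b \<in> A" "Y = R `` {b}"
        by (metis quotientE)
      then show "X = Y" using inj eq img by metis
    qed
    have "A // R = (\<lambda>a. R `` {a}) ` A" unfolding quotient_def by blast
    then show "(\<lambda>X. R' `` (f ` X)) ` (A // R) = (\<lambda>x. R' `` {f x}) ` A"
      unfolding image_image by (simp only: image_image) (rule image_cong[OF refl img])
  qed
qed

text \<open>Over a finite field the product of all X - a, increased by 1, is a nonconstant
  polynomial with constant value 1, hence without roots.\<close>

lemma infinite_alg_closed_field: "infinite (UNIV :: 'a::alg_closed_field set)"
proof
  assume fin: "finite (UNIV :: 'a set)"
  define q :: "'a poly" where "q = (\<Prod>a\<in>UNIV. [:- a, 1:]) + 1"
  have "degree (\<Prod>a\<in>UNIV. [:- a, 1 :: 'a:]) = card (UNIV :: 'a set)"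
    by (subst degree_prod_sum_eq) simp_all
  moreover have "card (UNIV :: 'a set) > 0"
    using fin by (simp add: card_gt_0_iff)
  ultimately have "degree q > 0"
    unfolding q_def by (subst degree_add_eq_left) simp_all
  then obtain x where "poly q x = 0" using alg_closed_imp_poly_has_root by blast
  moreover have "poly q x = 1"
    using fin by (simp add: q_def poly_prod prod_zero_iff)
  ultimately show False by simp
qed

text \<open>\<open>p choose Suc i\<close> is divisible by p, so by Pascal's rule neighbouring
  entries of row p - 1 are opposite modulo p. Hence (l - r)^(p-1) is the sum of the l^(p-1-i) r^i
  for commuting l and r.\<close>

lemma signed_binomial_CHAR_minus_1:
  assumes "CHAR('a::field) > 0" "i < CHAR('a)"
  shows "(- 1) ^ i * of_nat ((CHAR('a) - 1) choose i) = (1 :: 'a)"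
  using assms(2)
proof (induction i)
  case (Suc i)
  let ?p = "CHAR('a)"
  have "prime ?p" using prime_CHAR_semidom assms(1) by blast
  then have "?p dvd (?p choose Suc i)"
    using Suc.prems by (intro dvd_choose_prime) auto
  moreover have "?p choose Suc i = ((?p - 1) choose i) + ((?p - 1) choose Suc i)"
    using assms(1) by (cases ?p) simp_all
  ultimately have "of_nat ((?p - 1) choose i) + of_nat ((?p - 1) choose Suc i) = (0 :: 'a)"
    by (simp flip: of_nat_add add: of_nat_eq_0_iff_char_dvd)
  then have "of_nat ((?p - 1) choose Suc i) = - (of_nat ((?p - 1) choose i) :: 'a)"
    by (simp add: eq_neg_iff_add_eq_0 add.commute)
  then show ?case using Suc by simp
qed simp


section \<open>Powers of an even element on linear maps\<close>

context action_pair
begin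

text \<open>For even z the action on linear maps is l - r, where l composes with z on
  \<open>M\<close> and r precomposes with z on \<open>N\<close>. These commute, and the formula is
  the binomial theorem for (l - r)^j.\<close>

lemma iterate_act_Hom:
  assumes f: "linear_map N M f" and z: "z \<in> hpart L 0"
  shows "linear_map N M ((act (Hom_module L N M) z ^^ j) f)"
    and "(act (Hom_module L N M) z ^^ j) f n = (\<Sum>i\<le>j. scale M ((- 1) ^ i * of_nat (j choose i))
      ((act M z ^^ (j - i)) (f ((act N z ^^ i) n))))"
proof -
  show lin: "linear_map N M ((act (Hom_module L N M) z ^^ j) f)" for j
    by (induction j) (simp_all add: f linear_act_Hom)
  show "(act (Hom_module L N M) z ^^ j) f n = (\<Sum>i\<le>j. scale M ((- 1) ^ i * of_nat (j choose i))
      ((act M z ^^ (j - i)) (f ((act N z ^^ i) n))))"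
  proof (induction j arbitrary: n)
    case (Suc j)
    define c :: "nat \<Rightarrow> nat \<Rightarrow> 'f" where "c j i = (- 1) ^ i * of_nat (j choose i)" for i j
    define T where "T i = (act M z ^^ (Suc j - i)) (f ((act N z ^^ i) n))" for i
    \<comment> \<open>Pascal's rule for the signed coefficients.\<close>
    have c0: "c (Suc j) 0 = c j 0" and cS: "c (Suc j) (Suc i) = c j (Suc i) - c j i" for i
      by (simp_all add: c_def algebra_simps)
    have act_sum: "act M z (sum g A) = (\<Sum>i\<in>A. act M z (g i))" if "finite A" for g and A :: "nat set"
      using that by (induction A rule: finite_induct) (simp_all add: M.act_add)
    have "(act (Hom_module L N M) z ^^ Suc j) f n
      = act M z ((act (Hom_module L N M) z ^^ j) f n) - (act (Hom_module L N M) z ^^ j) f (act N z n)"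
      using act_Hom_homogeneous[OF lin z] by simp
    also have "act M z ((act (Hom_module L N M) z ^^ j) f n) = (\<Sum>i\<le>j. scale M (c j i) (T i))"
      unfolding Suc.IH act_sum[OF finite_atMost]
      by (intro sum.cong refl) (simp add: M.act_scale T_def c_def Suc_diff_le)
    \<comment> \<open>The added summand is 0 because \<open>j choose Suc j\<close> is 0; splitting
      off the summand at 0 then gives both sums the same range.\<close>
    also have "\<dots> = (\<Sum>i\<le>Suc j. scale M (c j i) (T i))"
      by (simp add: c_def binomial_eq_0)
    also have "\<dots> = scale M (c j 0) (T 0) + (\<Sum>i\<le>j. scale M (c j (Suc i)) (T (Suc i)))"
      by (rule sum.atMost_Suc_shift)
    also have "(act (Hom_module L N M) z ^^ j) f (act N z n) = (\<Sum>i\<le>j. scale M (c j i) (T (Suc i)))"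
      unfolding Suc.IH by (intro sum.cong refl) (simp add: T_def c_def funpow_swap1)
    also have "scale M (c j 0) (T 0) + (\<Sum>i\<le>j. scale M (c j (Suc i)) (T (Suc i)))
        - (\<Sum>i\<le>j. scale M (c j i) (T (Suc i)))
      = scale M (c (Suc j) 0) (T 0) + (\<Sum>i\<le>j. scale M (c (Suc j) (Suc i)) (T (Suc i)))"
      by (simp add: c0 cS M.scale_left_diff_distrib sum_subtractf)
    also have "\<dots> = (\<Sum>i\<le>Suc j. scale M (c (Suc j) i) (T i))"
      by (rule sum.atMost_Suc_shift[symmetric])
    finally show ?case by (simp only: c_def T_def)
  qed simp
qed

lemma iterate_act_Hom_CHAR:
  assumes "linear_map N M f" "z \<in> hpart L 0" "CHAR('f) > 0"
  shows "(act (Hom_module L N M) z ^^ (CHAR('f) - 1)) f n =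
    (\<Sum>i<CHAR('f). (act M z ^^ (CHAR('f) - 1 - i)) (f ((act N z ^^ i) n)))"
proof -
  have "{..CHAR('f) - 1} = {..<CHAR('f)}" using assms(3) by auto
  then show ?thesis
    unfolding iterate_act_Hom(2)[OF assms(1,2)]
    using signed_binomial_CHAR_minus_1[where 'a = 'f, OF assms(3)]
    by (intro sum.cong) simp_all
qed

end


section \<open>Homogeneous classes and the cardinality of the cohomology\<close>

context graded_action
begin

lemma iterate_act:
  assumes "z \<in> hpart L 0" "v \<in> carrier_of V"
  shows "(act V z ^^ j) v \<in> carrier_of V"
    and "component V b ((act V z ^^ j) v) = (act V z ^^ j) (component V b v)"
    and "(act V z ^^ j) (scale V c v) = scale V c ((act V z ^^ j) v)"
proof -
  show *: "(act V z ^^ j) v \<in> carrier_of V" for j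
    by (induction j) (simp_all add: assms act_carrier)
  show "component V b ((act V z ^^ j) v) = (act V z ^^ j) (component V b v)"
    using * by (induction j) (simp_all add: act_component[OF assms(1)])
  show "(act V z ^^ j) (scale V c v) = scale V c ((act V z ^^ j) v)"
    using * by (induction j) (simp_all add: act_scale)
qed

text \<open>Bracket and \<open>star\<close> shift parities by those of the elements of
  \<open>L\<close>, and even elements preserve them. Projecting the cocycle identities of \<phi> to
  one parity therefore yields those of its component, which splits H^1 into an even and an odd
  part.\<close>

lemma Z1_hom_component:
  assumes "restricted_lie_superalgebra L" "\<phi> \<in> Z1 L V"
  shows "hom_component L V k \<phi> \<in> Z1 L V"
proof -
  interpret R: restricted_lie_superalgebra L by fact
  have lin: "linear_map L V \<phi>"
    and br: "\<And>a b x y. x \<in> hpart L a \<Longrightarrow> y \<in> hpart L b \<Longrightarrow> \<phi> (bracket L x y) =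
      scale V (parity_sign (a * b)) (star L V x (\<phi> y)) - star L V y (\<phi> x)"
    and pm: "\<And>z. z \<in> hpart L 0 \<Longrightarrow> \<phi> (pmap L z) = (act V z ^^ (CHAR('f) - 1)) (\<phi> z)"
    using assms(2) unfolding Z1_iff by auto
  have \<phi>c: "\<phi> x \<in> carrier_of V" for x using linear_mapD(1)[OF lin] by simp
  show ?thesis
    unfolding Z1_iff
  proof (intro conjI allI ballI)
    show "linear_map L V (hom_component L V k \<phi>)"
      by (rule LV.hom_component_linear[OF lin])
  next
    fix a b x y assume x: "x \<in> hpart L a" and y: "y \<in> hpart L b"
    show "hom_component L V k \<phi> (bracket L x y) = scale V (parity_sign (a * b))
      (star L V x (hom_component L V k \<phi> y)) - star L V y (hom_component L V k \<phi> x)"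
      using x y
      by (simp add: LV.hom_component_eq[OF lin x] LV.hom_component_eq[OF lin y]
          LV.hom_component_eq[OF lin L.bracket_even[OF x y]] br component_diff component_scale
          star_component \<phi>c carrier_scale star_carrier add.commute add.left_commute)
  next
    fix z assume z: "z \<in> hpart L 0"
    show "hom_component L V k \<phi> (pmap L z) = (act V z ^^ (CHAR('f) - 1)) (hom_component L V k \<phi> z)"
      by (simp add: LV.hom_component_eq[OF lin z] LV.hom_component_eq[OF lin R.pmap_closed[OF z]]
          pm[OF z] iterate_act[OF z] \<phi>c)
  qed
qed

lemma Z1_scale:
  assumes "\<phi> \<in> Z1 L V"
  shows "(\<lambda>x. scale V c (\<phi> x)) \<in> Z1 L V"
proof -
  have "linear_map L V \<phi>" using assms unfolding Z1_iff by auto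
  then have \<phi>c: "\<phi> x \<in> carrier_of V" for x using linear_mapD(1) by fastforce
  show ?thesis
    using assms unfolding Z1_iff
    by (auto simp: linear_map_scale \<phi>c star_scale iterate_act(3) scale_right_diff_distrib mult.commute)
qed

text \<open>\<open>S\<close> will be the set of classes attained by extensions. If all cocycles of
  one parity are coboundaries, every class has a homogeneous representative and \<open>S\<close> is
  everything. Otherwise \<open>S\<close> is infinite; \<open>H1 L V\<close> embeds into
  \<open>S \<times> S\<close> through the two components, and \<open>S \<times> S\<close> is
  equipotent with \<open>S\<close>.\<close>

lemma H1_bij_betw_subset:
  assumes inf: "infinite (UNIV :: 'f set)" and RL: "restricted_lie_superalgebra L"
    and S: "S \<subseteq> H1 L V"
    and hom: "\<And>k \<phi>. \<phi> \<in> Z1 L V \<Longrightarrow> \<phi> \<in> hpart (Hom_space L V) k \<Longrightarrow> cohomologous L V `` {\<phi>} \<in> S"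
  shows "\<exists>g. bij_betw g S (H1 L V)"
proof -
  let ?R = "cohomologous L V"
  note eqv = equiv_cohomologous
  have lin: "linear_map L V \<phi>" if "\<phi> \<in> Z1 L V" for \<phi>
    using that unfolding Z1_iff by auto
  have hc: "hom_component L V k \<phi> \<in> Z1 L V" "hom_component L V k \<phi> \<in> hpart (Hom_space L V) k"
    if "\<phi> \<in> Z1 L V" for \<phi> k
    using Z1_hom_component[OF RL that] LV.hom_component_in_Hom[OF lin[OF that]] by auto
  have decomp: "\<phi> = hom_component L V k \<phi> + hom_component L V (k + 1) \<phi>" if "\<phi> \<in> Z1 L V" for \<phi> k
    using LV.hom_component_total[OF lin[OF that]]
    by (cases k) (simp_all add: fun_eq_iff add.commute)
  show ?thesis
  proof (cases "\<exists>k. Z1 L V \<inter> hpart (Hom_space L V) k \<subseteq> B1 L V")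
    case True
    then obtain k where k: "Z1 L V \<inter> hpart (Hom_space L V) k \<subseteq> B1 L V" by blast
    have "?R `` {\<phi>} \<in> S" if \<phi>: "\<phi> \<in> Z1 L V" for \<phi>
    proof -
      have "\<phi> - hom_component L V (k + 1) \<phi> = hom_component L V k \<phi>"
        using decomp[OF \<phi>, of k] by (metis add_diff_cancel_right')
      moreover have "hom_component L V k \<phi> \<in> B1 L V" using k hc[OF \<phi>] by blast
      ultimately have "(\<phi>, hom_component L V (k + 1) \<phi>) \<in> ?R"
        using \<phi> hc[OF \<phi>] by (simp add: cohomologous_def)
      then have "?R `` {\<phi>} = ?R `` {hom_component L V (k + 1) \<phi>}"
        by (rule equiv_class_eq[OF eqv])
      then show ?thesis using hom[OF hc[OF \<phi>]] by simp
    qed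
    then have "S = H1 L V" using S unfolding H1_eq by (auto elim!: quotientE)
    then show ?thesis using bij_betw_id by blast
  next
    case False
    have infS: "infinite S"
    proof -
      obtain \<phi> where \<phi>: "\<phi> \<in> Z1 L V" "\<phi> \<in> hpart (Hom_space L V) 0" "\<phi> \<notin> B1 L V"
        using False by blast
      \<comment> \<open>Distinct scalar multiples of a cocycle that is not a coboundary are not
        cohomologous: their difference could be divided by c - d.\<close>
      let ?F = "\<lambda>c. ?R `` {\<lambda>x. scale V c (\<phi> x)}"
      have "inj ?F"
      proof (rule injI, rule ccontr)
        fix c d assume "?F c = ?F d" and ne: "c \<noteq> d"
        then have "((\<lambda>x. scale V c (\<phi> x)), (\<lambda>x. scale V d (\<phi> x))) \<in> ?R"
          using eq_equiv_class[OF _ eqv Z1_scale[OF \<phi>(1)]] by blast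
        then have "(\<lambda>x. scale V c (\<phi> x)) - (\<lambda>x. scale V d (\<phi> x)) \<in> B1 L V"
          by (simp add: cohomologous_def)
        from B1_scale[OF this, of "1 / (c - d)"] have "\<phi> \<in> B1 L V"
          using ne by (simp flip: scale_left_diff_distrib)
        then show False using \<phi> by blast
      qed
      moreover have "range ?F \<subseteq> S"
        using hom[OF Z1_scale[OF \<phi>(1)] LV.H.hpart_scale[OF \<phi>(2), unfolded Hom_space_simps(1)]] by blast
      ultimately show ?thesis using inf finite_subset finite_imageD by blast
    qed
    \<comment> \<open>Components are taken of cocycles rather than of classes, so a representative
      of each class is fixed.\<close>
    define rep where "rep X = (SOME \<phi>. \<phi> \<in> X)" for X :: "('l \<Rightarrow> 'v) set"
    have rep: "rep X \<in> Z1 L V" "X = ?R `` {rep X}" if X: "X \<in> H1 L V" for X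
    proof -
      obtain \<phi> where \<phi>: "\<phi> \<in> Z1 L V" "X = ?R `` {\<phi>}"
        by (rule quotientE[OF X[unfolded H1_eq]])
      then have "rep X \<in> X"
        unfolding rep_def using equiv_class_self[OF eqv] by (metis someI)
      then have "(\<phi>, rep X) \<in> ?R" using \<phi> by blast
      then show "rep X \<in> Z1 L V" "X = ?R `` {rep X}"
        using equiv_class_eq[OF eqv, of \<phi> "rep X"] \<phi>(2) by (simp_all only: cohomologous_def mem_Collect_eq case_prod_conv)
    qed
    \<comment> \<open>The classes of the even and the odd part. Together they determine the class of
      the sum, since coboundaries are closed under addition.\<close>
    let ?G = "\<lambda>X. (?R `` {hom_component L V 0 (rep X)}, ?R `` {hom_component L V 1 (rep X)})"
    have inj_G: "inj_on ?G (H1 L V)"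
    proof (rule inj_onI)
      fix X Y assume X: "X \<in> H1 L V" and Y: "Y \<in> H1 L V" and G: "?G X = ?G Y"
      have "hom_component L V k (rep X) - hom_component L V k (rep Y) \<in> B1 L V" for k
        using G eq_equiv_class[OF _ eqv hc(1)[OF rep(1)[OF Y]]]
        by (cases k) (auto simp: cohomologous_def)
      from B1_add[OF this[of 0] this[of 1]] have "rep X - rep Y \<in> B1 L V"
        using decomp[OF rep(1)[OF X], of 0] decomp[OF rep(1)[OF Y], of 0]
        by (simp add: algebra_simps)
      then have "(rep X, rep Y) \<in> ?R" using rep(1)[OF X] rep(1)[OF Y] by (simp add: cohomologous_def)
      then show "X = Y" using rep(2)[OF X] rep(2)[OF Y] equiv_class_eq[OF eqv] by metis
    qed
    have sub_G: "?G ` H1 L V \<subseteq> S \<times> S"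
      using hom[OF hc] rep(1) by auto
    obtain f where f: "bij_betw f (S \<times> S) S"
      using card_of_Times_same_infinite[OF infS, folded card_of_ordIso] by blast
    have "inj_on (f \<circ> ?G) (H1 L V)"
      by (intro comp_inj_on inj_G inj_on_subset[OF bij_betw_imp_inj_on[OF f] sub_G])
    moreover have "(f \<circ> ?G) ` H1 L V \<subseteq> S"
      unfolding image_comp[symmetric] using image_mono[OF sub_G, of f] bij_betw_imp_surj_on[OF f] by simp
    ultimately show ?thesis
      by (intro Schroeder_Bernstein[of id S "H1 L V" "f \<circ> ?G"]) (simp_all only: inj_on_id image_id id_apply S)
  qed
qed

end


text \<open>Composition with an even isomorphism transports cocycles and coboundaries in both
  directions. It serves to identify \<open>M\<close> with the linear maps from the ground field to
  \<open>M\<close>.\<close>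

lemma H1_iso:
  assumes "graded_action L V" "graded_action L W" and J: "J \<in> homogeneous_hom L V W 0"
    and bij: "bij_betw J (carrier_of V) (carrier_of W)"
  shows "\<exists>\<Phi>. bij_betw \<Phi> (H1 L V) (H1 L W)"
proof -
  interpret V: graded_action L V by fact
  interpret W: graded_action L W by fact
  have Jl: "linear_map V W J"
    and Ja: "\<And>a x v. x \<in> hpart L 0 \<Longrightarrow> v \<in> carrier_of V \<Longrightarrow> J (act V x v) = act W x (J v)"
    using J unfolding homogeneous_hom_def by force+
  note Js = homogeneous_hom_star[OF assms(1-3)]
  note JJ = linear_mapD[OF Jl] linear_map_more[OF V.superspace_axioms W.superspace_axioms Jl]
  have inj: "J u = J v \<longleftrightarrow> u = v" if "u \<in> carrier_of V" "v \<in> carrier_of V" for u v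
    using bij that by (auto simp: bij_betw_def inj_on_def)
  have Jpow: "J ((act V z ^^ j) v) = (act W z ^^ j) (J v)" if "z \<in> hpart L 0" "v \<in> carrier_of V" for z j v
    by (induction j) (simp_all add: Ja that V.iterate_act(1))
  \<comment> \<open>An equivalence for arbitrary maps into the carrier, so that it also covers the
    pullback of a cocycle along the inverse of J, whose linearity is then part of the
    conclusion.\<close>
  have Z: "J \<circ> \<phi> \<in> Z1 L W \<longleftrightarrow> \<phi> \<in> Z1 L V" if \<phi>: "\<And>x. \<phi> x \<in> carrier_of V" for \<phi>
  proof -
    have lin: "linear_map L W (J \<circ> \<phi>) \<longleftrightarrow> linear_map L V \<phi>"
      unfolding linear_map_def by (simp add: \<phi> JJ V.carrier_add V.carrier_scale inj flip: JJ(2,3))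
    have br: "(J \<circ> \<phi>) (bracket L x y) = scale W (parity_sign (a * b)) (star L W x ((J \<circ> \<phi>) y))
        - star L W y ((J \<circ> \<phi>) x) \<longleftrightarrow>
      \<phi> (bracket L x y) = scale V (parity_sign (a * b)) (star L V x (\<phi> y)) - star L V y (\<phi> x)"
      for a b x y
    proof -
      have "scale W (parity_sign (a * b)) (star L W x ((J \<circ> \<phi>) y)) - star L W y ((J \<circ> \<phi>) x)
        = J (scale V (parity_sign (a * b)) (star L V x (\<phi> y)) - star L V y (\<phi> x))"
        by (simp add: \<phi> Js JJ V.star_carrier V.carrier_scale)
      then show ?thesis
        by (simp add: inj \<phi> V.carrier_diff V.carrier_scale V.star_carrier)
    qed
    have pm: "(J \<circ> \<phi>) (pmap L z) = (act W z ^^ j) ((J \<circ> \<phi>) z) \<longleftrightarrow>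
      \<phi> (pmap L z) = (act V z ^^ j) (\<phi> z)" if "z \<in> hpart L 0" for z j
      using that by (simp add: inj \<phi> V.iterate_act(1) flip: Jpow)
    show ?thesis
      unfolding V.Z1_iff W.Z1_iff lin br using pm by simp
  qed
  have val: "\<phi> x \<in> carrier_of V" if "\<phi> \<in> Z1 L V" for \<phi> x
    using that linear_mapD(1) unfolding V.Z1_iff by fastforce
  have B: "(\<lambda>x. J (\<phi> x)) \<in> B1 L W \<longleftrightarrow> \<phi> \<in> B1 L V" if \<phi>: "\<And>x. \<phi> x \<in> carrier_of V" for \<phi>
  proof
    assume "\<phi> \<in> B1 L V"
    then show "(\<lambda>x. J (\<phi> x)) \<in> B1 L W"
      unfolding V.B1_iff W.B1_iff by (auto simp: Js JJ)
  next
    assume "(\<lambda>x. J (\<phi> x)) \<in> B1 L W"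
    then obtain w where w: "w \<in> carrier_of W" "\<And>x. J (\<phi> x) = star L W x w"
      unfolding W.B1_iff by (auto simp: fun_eq_iff)
    then obtain v where v: "v \<in> carrier_of V" "w = J v"
      using bij by (auto simp: bij_betw_def)
    then have "J (\<phi> x) = J (star L V x v)" for x
      using w(2)[of x] Js[OF v(1), of x] by simp
    then have "\<phi> x = star L V x v" for x
      using inj[OF \<phi> V.star_carrier[OF v(1)]] by blast
    then show "\<phi> \<in> B1 L V" unfolding V.B1_iff using v by auto
  qed
  have "bij_betw (\<lambda>X. cohomologous L W `` ((\<lambda>\<phi>. J \<circ> \<phi>) ` X)) (Z1 L V // cohomologous L V)
    ((\<lambda>\<phi>. cohomologous L W `` {J \<circ> \<phi>}) ` Z1 L V)"
  proof (rule quotient_bij_betw[OF W.equiv_cohomologous])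
    show "J \<circ> \<phi> \<in> Z1 L W" if "\<phi> \<in> Z1 L V" for \<phi>
      using that Z val by blast
    have "(J \<circ> \<phi>) - (J \<circ> \<psi>) \<in> B1 L W \<longleftrightarrow> \<phi> - \<psi> \<in> B1 L V"
      if "\<phi> \<in> Z1 L V" "\<psi> \<in> Z1 L V" for \<phi> \<psi>
    proof -
      have "(J \<circ> \<phi>) - (J \<circ> \<psi>) = (\<lambda>x. J ((\<phi> - \<psi>) x))"
        using that val by (auto simp: fun_eq_iff JJ)
      moreover have "(\<phi> - \<psi>) x \<in> carrier_of V" for x
        using that val V.carrier_diff by simp
      ultimately show ?thesis using B by presburger
    qed
    then show "cohomologous L V = {(\<phi>, \<psi>). \<phi> \<in> Z1 L V \<and> \<psi> \<in> Z1 L V \<and> (J \<circ> \<phi>, J \<circ> \<psi>) \<in> cohomologous L W}"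
      using Z val unfolding cohomologous_def by blast
  qed
  moreover have "(\<lambda>\<phi>. cohomologous L W `` {J \<circ> \<phi>}) ` Z1 L V = Z1 L W // cohomologous L W"
  proof -
    have "\<psi> \<in> (\<lambda>\<phi>. J \<circ> \<phi>) ` Z1 L V" if \<psi>: "\<psi> \<in> Z1 L W" for \<psi>
    proof -
      have "\<psi> x \<in> J ` carrier_of V" for x
        using \<psi> bij linear_mapD(1)[of L W \<psi> x] unfolding W.Z1_iff by (auto simp: bij_betw_def)
      then have \<phi>: "inv_into (carrier_of V) J (\<psi> x) \<in> carrier_of V"
        "J (inv_into (carrier_of V) J (\<psi> x)) = \<psi> x" for x
        by (rule inv_into_into, rule f_inv_into_f)
      then have "\<psi> = J \<circ> (\<lambda>x. inv_into (carrier_of V) J (\<psi> x))"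
        by (simp add: fun_eq_iff)
      then show ?thesis using Z[of "\<lambda>x. inv_into (carrier_of V) J (\<psi> x)", OF \<phi>(1)] \<psi> by auto
    qed
    moreover have "(\<lambda>\<phi>. J \<circ> \<phi>) ` Z1 L V \<subseteq> Z1 L W"
      using Z val by blast
    ultimately have "Z1 L W = (\<lambda>\<phi>. J \<circ> \<phi>) ` Z1 L V" by (simp only: subset_antisym subsetI)
    moreover have "Z1 L W // cohomologous L W = (\<lambda>\<psi>. cohomologous L W `` {\<psi>}) ` Z1 L W"
      unfolding quotient_def by blast
    ultimately show ?thesis by (simp only: image_image)
  qed
  ultimately show ?thesis unfolding H1_eq by auto
qed


section \<open>Cocycles of extensions\<close>

lemma lmodule_homI:
  assumes "graded_action L V" "graded_action L W" and lin: "linear_map V W f"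
    and st: "\<And>a x v. x \<in> hpart L a \<Longrightarrow> v \<in> carrier_of V \<Longrightarrow> f (star L V x v) = star L W x (f v)"
  shows "f \<in> lmodule_hom L V W"
proof -
  interpret V: graded_action L V by fact
  interpret W: graded_action L W by fact
  have "f (star L V x v) = star L W x (f v)" if v: "v \<in> carrier_of V" for x v
    using V.L.in_carrier[of x]
  proof (induction rule: V.L.carrier_induct)
    case (add x y)
    then show ?case
      by (simp add: V.star_add_left W.star_add_left v linear_mapD[OF lin] V.star_carrier)
  qed (rule st[OF _ v])
  then show ?thesis using lin lmodule_hom_iff[OF assms(1,2)] by blast
qed

text \<open>Lifts are prescribed on a basis of \<open>N\<close>; membership in the carrier of
  \<open>E\<close> and the section property pass from the basis to its span. No parity condition is
  imposed on the section, hence none on the cocycle obtained from it.\<close>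

lemma linear_section:
  assumes "superspace E" "superspace N" "carrier_of N = UNIV"
    and \<pi>: "linear_map E N \<pi>" "\<pi> ` carrier_of E = UNIV"
  shows "\<exists>s. linear_map N E s \<and> (\<forall>n. \<pi> (s n) = n)"
proof -
  interpret E: superspace E by fact
  interpret N: superspace N by fact
  interpret NE: vector_space_pair "scale N" "scale E" by unfold_locales
  obtain B where B: "N.independent B" "UNIV \<subseteq> N.span B"
    using N.maximal_independent_subset by (metis UNIV_I subsetI)
  have "\<exists>e. e \<in> carrier_of E \<and> \<pi> e = n" for n
    using \<pi>(2) by (metis UNIV_I imageE)
  then obtain g where g: "\<And>n. g n \<in> carrier_of E" "\<And>n. \<pi> (g n) = n" by metis
  obtain s where s: "Vector_Spaces.linear (scale N) (scale E) s" "\<And>b. b \<in> B \<Longrightarrow> s b = g b"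
    using NE.linear_independent_extend[OF B(1)] by blast
  have "s n \<in> carrier_of E \<and> \<pi> (s n) = n" for n
  proof -
    have "n \<in> N.span B" using B(2) by blast
    then show ?thesis
    proof (induction rule: N.span_induct_alt)
      case base
      then show ?case
        using s(1) linear_map_more(1)[OF assms(1,2) \<pi>(1)] by (simp add: NE.linear_0)
    next
      case (step c x y)
      then show ?case
        using s g by (simp add: NE.linear_add NE.linear_scale E.carrier_add E.carrier_scale
            linear_mapD[OF \<pi>(1)])
    qed
  qed
  then show ?thesis
    using s(1) by (intro exI[of _ s]) (simp add: linear_map_def NE.linear_add NE.linear_scale)
qed

text \<open>Moving \<delta>^a past y gives x * (y * v) = (-1)^(ab) x y \<delta>^(a+b) v. So,
  compared with the relation for \<open>act\<close>, the sign moves from the second product to the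
  first, as in the cocycle condition.\<close>

lemma (in restricted_module) star_bracket:
  assumes "lie_superalgebra L" "x \<in> hpart L a" "y \<in> hpart L b" "v \<in> carrier_of V"
  shows "star L V (bracket L x y) v =
    scale V (parity_sign (a * b)) (star L V x (star L V y v)) - star L V y (star L V x v)"
proof -
  interpret G: graded_action L V by (rule graded_actionI[OF assms(1)])
  have "star L V (bracket L x y) v = act V x (act V y (twist V (a + b) v))
      - scale V (parity_sign (a * b)) (act V y (act V x (twist V (a + b) v)))"
    using assms
    by (simp add: G.star_homogeneous[OF G.L.bracket_even] act_bracket twist_in_carrier)
  moreover have "star L V x (star L V y v) =
      scale V (parity_sign (a * b)) (act V x (act V y (twist V (a + b) v)))"
    using assms
    by (simp add: G.star_homogeneous G.act_carrier twist_in_carrier G.twist_act G.act_scale twist_twist)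
  moreover have "star L V y (star L V x v) =
      scale V (parity_sign (a * b)) (act V y (act V x (twist V (a + b) v)))"
    using assms
    by (simp add: G.star_homogeneous G.act_carrier twist_in_carrier G.twist_act G.act_scale twist_twist
        add.commute mult.commute)
  ultimately show ?thesis by simp
qed


section \<open>Cocycles with values in the linear maps from N to M\<close>

locale restricted_pair = action_pair L N M + R: restricted_lie_superalgebra L
    + RN: restricted_module L N + RM: restricted_module L M
  for L :: "('f::field, 'l::ab_group_add, 'x) lie_superalgebra_scheme"
  and N :: "('f, 'l, 'n::ab_group_add, 'y) lmodule_scheme"
  and M :: "('f, 'l, 'm::ab_group_add, 'z) lmodule_scheme" +
  assumes CHAR_pos: "CHAR('f) > 0"
begin

lemma lie_L: "lie_superalgebra L"
  by (rule N.L.lie_superalgebra_axioms)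

lemma Z1_D:
  assumes "\<phi> \<in> Z1 L (Hom_module L N M)"
  shows "linear_map N M (\<phi> x)" "\<phi> (x + y) n = \<phi> x n + \<phi> y n" "\<phi> (scale L c x) n = scale M c (\<phi> x n)"
proof -
  have "linear_map L (Hom_module L N M) \<phi>" using assms HM.Z1_iff by blast
  from linear_mapD[OF this] show "linear_map N M (\<phi> x)" "\<phi> (x + y) n = \<phi> x n + \<phi> y n"
    "\<phi> (scale L c x) n = scale M c (\<phi> x n)" by (simp_all add: Hom_module_eqs)
qed

text \<open>The cocycle conditions evaluated at n; the p-condition becomes a sum because z^(p-1)
  acts on linear maps as the sum of the l^(p-1-i) r^i.\<close>

lemma Z1_Hom_iff:
  assumes lin: "linear_map L (Hom_module L N M) \<phi>"
  shows "\<phi> \<in> Z1 L (Hom_module L N M) \<longleftrightarrow>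
    (\<forall>a b. \<forall>x\<in>hpart L a. \<forall>y\<in>hpart L b. \<forall>n. \<phi> (bracket L x y) n =
      scale M (parity_sign (a * b)) (star L M x (\<phi> y (twist N a n)) - \<phi> y (act N x n))
      - (star L M y (\<phi> x (twist N b n)) - \<phi> x (act N y n))) \<and>
    (\<forall>z\<in>hpart L 0. \<forall>n. \<phi> (pmap L z) n =
      (\<Sum>i<CHAR('f). (act M z ^^ (CHAR('f) - 1 - i)) (\<phi> z ((act N z ^^ i) n))))"
proof -
  have \<phi>: "linear_map N M (\<phi> x)" for x
    using linear_mapD(1)[OF lin] by (simp add: Hom_module_eqs)
  show ?thesis
    unfolding HM.Z1_iff using lin
    by (simp add: fun_eq_iff star_Hom[OF \<phi>] iterate_act_Hom_CHAR[OF \<phi> _ CHAR_pos, simplified] cong: ball_cong)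
qed

end


section \<open>The cocycle of an extension\<close>

locale restricted_extension = restricted_pair L N M
  for L :: "('f::field, 'l::ab_group_add, 'x) lie_superalgebra_scheme"
  and N :: "('f, 'l, 'n::ab_group_add, 'y) lmodule_scheme"
  and M :: "('f, 'l, 'm::ab_group_add, 'z) lmodule_scheme" +
  fixes E :: "('f, 'l, 'e::ab_group_add) lmodule" and \<iota> \<pi>
  assumes ext: "(E, \<iota>, \<pi>) \<in> restricted_extensions L N M"
begin

lemma restricted_module_E: "restricted_module L E"
  using ext by (simp add: restricted_extensions_def)

sublocale E: graded_action L E
  by (rule restricted_module.graded_actionI[OF restricted_module_E lie_L])

sublocale RE: restricted_module L E
  by (rule restricted_module_E)

lemma inc_linear: "linear_map M E \<iota>" and inc_star: "\<iota> (star L M x m) = star L E x (\<iota> m)"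
  using ext lmodule_hom_iff[OF M.graded_action_axioms E.graded_action_axioms]
  by (simp_all add: restricted_extensions_def)

lemma proj_linear: "linear_map E N \<pi>"
  and proj_star: "e \<in> carrier_of E \<Longrightarrow> \<pi> (star L E x e) = star L N x (\<pi> e)"
  using ext lmodule_hom_iff[OF E.graded_action_axioms N.graded_action_axioms]
  by (simp_all add: restricted_extensions_def)

lemmas incD = linear_mapD[OF inc_linear, simplified]
  linear_map_more[OF M.superspace_axioms E.superspace_axioms inc_linear, simplified]

lemmas projD = linear_mapD(2,3)[OF proj_linear]
  linear_map_more[OF E.superspace_axioms N.superspace_axioms proj_linear]

lemma inc_eq_iff: "\<iota> m = \<iota> m' \<longleftrightarrow> m = m'"
  using ext by (auto simp: restricted_extensions_def M_UNIV inj_on_def)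

lemma proj_inc [simp]: "\<pi> (\<iota> m) = 0"
  using ext by (auto simp: restricted_extensions_def M_UNIV)

text \<open>By exactness the values of g have preimages under \<iota>; injectivity of \<iota> makes
  them unique and therefore linear in the argument.\<close>

lemma lift_to_kernel:
  assumes "linear_map A E g" and "\<And>v. v \<in> carrier_of A \<Longrightarrow> \<pi> (g v) = 0"
    and "\<And>u v. u \<in> carrier_of A \<Longrightarrow> v \<in> carrier_of A \<Longrightarrow> u + v \<in> carrier_of A"
    and "\<And>c v. v \<in> carrier_of A \<Longrightarrow> scale A c v \<in> carrier_of A"
  shows "\<exists>h. linear_map A M h \<and> (\<forall>v\<in>carrier_of A. \<iota> (h v) = g v)"
proof -
  have "\<iota> ` UNIV = {e \<in> carrier_of E. \<pi> e = 0}"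
    using ext by (simp add: restricted_extensions_def M_UNIV)
  then have "\<exists>m. \<iota> m = g v" if "v \<in> carrier_of A" for v
    using linear_mapD(1)[OF assms(1) that] assms(2)[OF that] by (metis (mono_tags, lifting) imageE mem_Collect_eq)
  then obtain h where h: "\<And>v. v \<in> carrier_of A \<Longrightarrow> \<iota> (h v) = g v" by metis
  have "linear_map A M h"
    unfolding linear_map_def
    by (auto simp: h assms(3,4) linear_mapD[OF assms(1)] incD simp flip: inc_eq_iff)
  then show ?thesis using h by blast
qed

lemma inc_iterate_act: "z \<in> hpart L 0 \<Longrightarrow> \<iota> ((act M z ^^ j) m) = (act E z ^^ j) (\<iota> m)"
proof (induction j)
  case (Suc j)
  have "\<iota> (act M z m') = act E z (\<iota> m')" for m'
    using inc_star[of z m'] Suc.prems by (simp add: M.star_homogeneous E.star_homogeneous incD)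
  then show ?case using Suc by simp
qed simp

text \<open>Since x * \<delta>^a n = xn, the last equation says that \<iota> \<phi>(x) is the
  failure of the section to commute with \<open>star\<close>.\<close>

definition is_section :: "('n \<Rightarrow> 'e) \<Rightarrow> ('l \<Rightarrow> 'n \<Rightarrow> 'm) \<Rightarrow> bool" where
  "is_section s \<phi> \<longleftrightarrow> linear_map N E s \<and> (\<forall>n. \<pi> (s n) = n) \<and>
    (\<forall>a. \<forall>x\<in>hpart L a. \<forall>n. star L E x (s (twist N a n)) = s (act N x n) + \<iota> (\<phi> x n))"

text \<open>The failure of a linear section to commute with \<open>star\<close> lies in the kernel
  of \<pi>, so it comes from \<open>M\<close>. It satisfies the bracket condition because
  \<open>E\<close> and \<open>N\<close> are modules, and the p-condition because both are
  restricted.\<close>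

lemma ex_cocycle: "\<exists>\<phi>\<in>Z1 L (Hom_module L N M). \<exists>s. is_section s \<phi>"
proof -
  have "\<pi> ` carrier_of E = UNIV" using ext by (simp add: restricted_extensions_def N_UNIV)
  then obtain s where s: "linear_map N E s" "\<And>n. \<pi> (s n) = n"
    using linear_section[OF E.superspace_axioms N.superspace_axioms N_UNIV proj_linear] by blast
  note sD = linear_mapD[OF s(1), simplified]
    linear_map_more[OF N.superspace_axioms E.superspace_axioms s(1), simplified]
  \<comment> \<open>The failure of s to commute with \<open>star\<close>, extended linearly in
    x.\<close>
  define g where "g x n = (\<Sum>a\<in>{0, 1}. star L E (component L a x) (s (twist N a n))
    - s (act N (component L a x) n))" for x n
  have g_hom: "g x n = star L E x (s (twist N a n)) - s (act N x n)" if "x \<in> hpart L a" for x a n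
    using that linear_map_more(1)[OF N.L.superspace_axioms E.superspace_axioms E.linear_map_star_left]
    unfolding g_def sum_bit
    by (cases a) (simp_all add: N.L.component_homogeneous sD)
  have g1: "linear_map N E (g x)" for x
    unfolding g_def sum_bit
    by (intro E.linear_map_plus E.linear_map_diff linear_map_comp[OF N.linear_map_twist]
        linear_map_comp[OF s(1) E.linear_map_star] linear_map_comp[OF N.linear_right s(1)])
  have g2: "linear_map L E (\<lambda>x. g x n)" for n
    unfolding g_def sum_bit
    by (intro E.linear_map_plus E.linear_map_diff linear_map_comp[OF N.L.linear_map_component]
        linear_map_comp[OF N.linear_left s(1)] E.linear_map_star_left sD(1) NM.V_carrier)
  have "\<pi> (g x n) = 0" for x n
    by (simp add: g_def projD sD E.star_carrier E.carrier_diff E.carrier_add proj_star s(2)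
        N.star_homogeneous[OF N.L.component_in])
  then have "\<exists>h. linear_map N M h \<and> (\<forall>n. \<iota> (h n) = g x n)" for x
    using lift_to_kernel[OF g1] by (simp add: N_UNIV)
  then obtain \<phi> where \<phi>: "\<And>x. linear_map N M (\<phi> x)" "\<And>x n. \<iota> (\<phi> x n) = g x n" by metis
  have lin: "linear_map L (Hom_module L N M) \<phi>"
    unfolding linear_map_def
    by (auto simp: Hom_module_eqs \<phi> fun_eq_iff linear_mapD[OF g2] incD simp flip: inc_eq_iff)
  have \<phi>h: "\<iota> (\<phi> x n) = star L E x (s (twist N a n)) - s (act N x n)" if "x \<in> hpart L a" for x a n
    using \<phi>(2) g_hom[OF that] by simp
  have "\<phi> \<in> Z1 L (Hom_module L N M)"
    unfolding Z1_Hom_iff[OF lin]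
  proof (intro conjI allI ballI)
    fix a b x y n assume x: "x \<in> hpart L a" and y: "y \<in> hpart L b"
    have xy: "bracket L x y \<in> hpart L (a + b)" by (rule N.L.bracket_even[OF x y])
    \<comment> \<open>In both orders, two applications of \<open>star\<close> lead to the argument
      \<delta>^(a+b) n of s.\<close>
    define t where "t = twist N (a + b) n"
    have e1: "\<iota> (\<phi> (bracket L x y) n) = scale E (parity_sign (a * b)) (star L E x (star L E y (s t)))
      - star L E y (star L E x (s t))
      - (s (act N x (act N y n)) - scale E (parity_sign (a * b)) (s (act N y (act N x n))))"
      unfolding \<phi>h[OF xy] t_def[symmetric]
      by (simp add: RE.star_bracket[OF lie_L x y] sD RN.act_bracket[OF x y])
    have e2: "\<iota> (star L M x (\<phi> y (twist N a n))) = star L E x (star L E y (s t))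
        - star L E x (s (act N y (twist N a n)))"
      by (simp add: inc_star \<phi>h[OF y] E.star_diff sD E.star_carrier N.twist_twist t_def add.commute)
    have e3: "\<iota> (star L M y (\<phi> x (twist N b n))) = star L E y (star L E x (s t))
        - star L E y (s (act N x (twist N b n)))"
      by (simp add: inc_star \<phi>h[OF x] E.star_diff sD E.star_carrier N.twist_twist t_def add.commute)
    have e4: "\<iota> (\<phi> y (act N x n)) =
        scale E (parity_sign (a * b)) (star L E y (s (act N x (twist N b n)))) - s (act N y (act N x n))"
      by (simp add: \<phi>h[OF y] N.twist_act[OF x] sD E.star_scale mult.commute)
    have e5: "\<iota> (\<phi> x (act N y n)) =
        scale E (parity_sign (a * b)) (star L E x (s (act N y (twist N a n)))) - s (act N x (act N y n))"
      by (simp add: \<phi>h[OF x] N.twist_act[OF y] sD E.star_scale mult.commute)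
    \<comment> \<open>The mixed terms, with one factor acting in \<open>E\<close> and one in
      \<open>N\<close>, occur in \<open>e2\<close>, \<open>e3\<close> and again in
      \<open>e4\<close>, \<open>e5\<close>, and cancel.\<close>
    have "\<iota> (\<phi> (bracket L x y) n) = \<iota> (scale M (parity_sign (a * b))
        (star L M x (\<phi> y (twist N a n)) - \<phi> y (act N x n))
      - (star L M y (\<phi> x (twist N b n)) - \<phi> x (act N y n)))"
      by (simp only: incD e1 e2 e3 e4 e5) (cases a; cases b; simp add: algebra_simps)
    then show "\<phi> (bracket L x y) n = scale M (parity_sign (a * b))
        (star L M x (\<phi> y (twist N a n)) - \<phi> y (act N x n))
      - (star L M y (\<phi> x (twist N b n)) - \<phi> x (act N y n))"
      by (simp add: inc_eq_iff)
  next
    fix z n assume z: "z \<in> hpart L 0"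
    let ?p = "CHAR('f)"
    \<comment> \<open>Chosen so that the i-th summand is a difference of neighbours: z^(p-1-i) is
      applied to z s(z^i n) - s(z^(i+1) n).\<close>
    define U where "U i = (act E z ^^ (?p - i)) (s ((act N z ^^ i) n))" for i
    have inc_sum: "\<iota> (sum h A) = (\<Sum>i\<in>A. \<iota> (h i))" if "finite A" for h and A :: "nat set"
      using that by (induction A rule: finite_induct) (simp_all add: incD)
    have it_diff: "(act E z ^^ j) (u - v) = (act E z ^^ j) u - (act E z ^^ j) v"
      if "u \<in> carrier_of E" "v \<in> carrier_of E" for u v j
      by (induction j) (simp_all add: that E.act_diff E.iterate_act(1)[OF z])
    have "\<iota> ((act M z ^^ (?p - 1 - i)) (\<phi> z ((act N z ^^ i) n))) = U i - U (Suc i)" if i: "i < ?p" for i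
    proof -
      have "(act E z ^^ (?p - 1 - i)) (act E z v) = (act E z ^^ (?p - i)) v" for v
        using i by (simp flip: funpow_swap1 funpow.simps(2)[THEN fun_cong, unfolded o_def] add: Suc_diff_Suc)
      then show ?thesis
        by (simp add: inc_iterate_act[OF z] \<phi>h[OF z] U_def E.star_homogeneous[OF z] sD it_diff E.act_carrier)
    qed
    then have "\<iota> (\<Sum>i<?p. (act M z ^^ (?p - 1 - i)) (\<phi> z ((act N z ^^ i) n))) = (\<Sum>i<?p. U i - U (Suc i))"
      by (simp add: inc_sum)
    also have "\<dots> = U 0 - U ?p" by (rule sum_lessThan_telescope')
    \<comment> \<open>The end terms are z^p s(n) and s(z^p n); restrictedness of \<open>E\<close>
      and of \<open>N\<close> replaces z^p by \<open>pmap L z\<close>.\<close>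
    also have "\<dots> = \<iota> (\<phi> (pmap L z) n)"
      using R.pmap_closed[OF z]
      by (simp add: U_def \<phi>h[of _ 0] E.star_homogeneous sD RE.act_pmap[OF z] RN.act_pmap[OF z])
    finally show "\<phi> (pmap L z) n = (\<Sum>i<?p. (act M z ^^ (?p - 1 - i)) (\<phi> z ((act N z ^^ i) n)))"
      by (simp add: inc_eq_iff)
  qed
  moreover have "is_section s \<phi>"
    unfolding is_section_def using s \<phi>h by simp
  ultimately show ?thesis by blast
qed

end


section \<open>Equivalence of extensions and cohomologous cocycles\<close>

context restricted_extension
begin

text \<open>A section splits \<open>E\<close> linearly: each e is uniquely of the form s(n) +
  \<iota>(m), and r is the coordinate in \<open>M\<close>, obtained by lifting e - s(\<pi>
  e).\<close>

lemma section_decomp: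
  assumes s: "is_section s \<phi>"
  shows "\<exists>r. linear_map E M r \<and> (\<forall>e\<in>carrier_of E. e = s (\<pi> e) + \<iota> (r e)) \<and>
    (\<forall>n m. \<pi> (s n + \<iota> m) = n \<and> r (s n + \<iota> m) = m)"
proof -
  have sl: "linear_map N E s" and \<pi>s: "\<And>n. \<pi> (s n) = n"
    using s unfolding is_section_def by auto
  note sD = linear_mapD(1)[OF sl, simplified]
  have lin: "linear_map E E (\<lambda>e. e - s (\<pi> e))"
    by (intro E.linear_map_diff linear_map_comp[OF proj_linear sl]) (simp add: linear_map_def)
  have "\<pi> (e - s (\<pi> e)) = 0" if "e \<in> carrier_of E" for e
    using that by (simp add: projD sD \<pi>s)
  then obtain r where r: "linear_map E M r" "\<And>e. e \<in> carrier_of E \<Longrightarrow> \<iota> (r e) = e - s (\<pi> e)"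
    using lift_to_kernel[OF lin] E.carrier_add E.carrier_scale by blast
  have \<pi>sm: "\<pi> (s n + \<iota> m) = n" for n m
    by (simp add: projD sD incD \<pi>s)
  then have "\<iota> (r (s n + \<iota> m)) = \<iota> m" for n m
    using r(2)[OF E.carrier_add[OF sD incD(1)]] by simp
  then show ?thesis
    using r \<pi>sm by (intro exI[of _ r]) (simp add: inc_eq_iff)
qed

end


text \<open>In the coordinates given by the sections, an equivalence has the form s1(n) +
  \<iota>1(m) \<mapsto> s2(n) + \<iota>2(h(n) + m) with h linear. It commutes with
  \<open>star\<close> exactly when \<phi>1 - \<phi>2 is the coboundary of h.\<close>

lemma equivalent_iff_cohomologous:
  assumes "restricted_extension L N M E1 \<iota>1 \<pi>1" "restricted_extension L N M E2 \<iota>2 \<pi>2"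
    and s1: "restricted_extension.is_section L N E1 \<iota>1 \<pi>1 s1 \<phi>1"
    and s2: "restricted_extension.is_section L N E2 \<iota>2 \<pi>2 s2 \<phi>2"
    and Z: "\<phi>1 \<in> Z1 L (Hom_module L N M)" "\<phi>2 \<in> Z1 L (Hom_module L N M)"
  shows "((E1, \<iota>1, \<pi>1), (E2, \<iota>2, \<pi>2)) \<in> extension_equivalence L N M \<longleftrightarrow>
    \<phi>1 - \<phi>2 \<in> B1 L (Hom_module L N M)"
proof -
  interpret X1: restricted_extension L N M E1 \<iota>1 \<pi>1 by fact
  interpret X2: restricted_extension L N M E2 \<iota>2 \<pi>2 by fact
  have s1l: "linear_map N E1 s1" and p1: "\<And>n. \<pi>1 (s1 n) = n"
    and c1: "\<And>a x n. x \<in> hpart L a \<Longrightarrow> star L E1 x (s1 (twist N a n)) = s1 (act N x n) + \<iota>1 (\<phi>1 x n)"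
    using s1 unfolding X1.is_section_def by auto
  have s2l: "linear_map N E2 s2" and p2: "\<And>n. \<pi>2 (s2 n) = n"
    and c2: "\<And>a x n. x \<in> hpart L a \<Longrightarrow> star L E2 x (s2 (twist N a n)) = s2 (act N x n) + \<iota>2 (\<phi>2 x n)"
    using s2 unfolding X2.is_section_def by auto
  note s1D = linear_mapD[OF s1l, simplified]
    linear_map_more[OF X1.N.superspace_axioms X1.E.superspace_axioms s1l, simplified]
  note s2D = linear_mapD[OF s2l, simplified]
    linear_map_more[OF X1.N.superspace_axioms X2.E.superspace_axioms s2l, simplified]
  \<comment> \<open>Cocycles and coboundaries are additive in x, so the equation may be tested on
    homogeneous x.\<close>
  have B: "\<phi>1 - \<phi>2 \<in> B1 L (Hom_module L N M) \<longleftrightarrow> (\<exists>h. linear_map N M h \<and>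
    (\<forall>a. \<forall>x\<in>hpart L a. \<forall>n. \<phi>1 x n - \<phi>2 x n = star L M x (h (twist N a n)) - h (act N x n)))"
    (is "_ \<longleftrightarrow> (\<exists>h. _ \<and> ?cob h)")
  proof -
    have "\<phi>1 - \<phi>2 = (\<lambda>x. star L (Hom_module L N M) x h) \<longleftrightarrow> ?cob h" if h: "linear_map N M h" for h
    proof
      assume "\<phi>1 - \<phi>2 = (\<lambda>x. star L (Hom_module L N M) x h)"
      then have "\<phi>1 x n - \<phi>2 x n = star L (Hom_module L N M) x h n" for x n
        by (metis minus_apply)
      then show "?cob h" by (simp add: X1.star_Hom[OF h])
    next
      assume R: "?cob h"
      have "\<phi>1 x n - \<phi>2 x n = star L (Hom_module L N M) x h n" for x n
        using X1.N.L.in_carrier[of x]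
      proof (induction rule: X1.N.L.carrier_induct)
        case (add x y)
        have "star L (Hom_module L N M) (x + y) h n
          = star L (Hom_module L N M) x h n + star L (Hom_module L N M) y h n"
          using h by (simp add: X1.HM.star_add_left X1.Hom_module_eqs)
        then show ?case using add by (simp add: X1.Z1_D[OF Z(1)] X1.Z1_D[OF Z(2)] add_diff_add)
      qed (use R in \<open>simp add: X1.star_Hom[OF h]\<close>)
      then show "\<phi>1 - \<phi>2 = (\<lambda>x. star L (Hom_module L N M) x h)" by (simp add: fun_eq_iff)
    qed
    then show ?thesis unfolding X1.HM.B1_iff by (auto simp: X1.Hom_module_eqs)
  qed
  show ?thesis
    unfolding B
  proof
    assume "((E1, \<iota>1, \<pi>1), (E2, \<iota>2, \<pi>2)) \<in> extension_equivalence L N M"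
    then obtain \<sigma> where \<sigma>: "\<sigma> \<in> lmodule_hom L E1 E2" "\<And>m. \<sigma> (\<iota>1 m) = \<iota>2 m"
      "\<And>e. e \<in> carrier_of E1 \<Longrightarrow> \<pi>2 (\<sigma> e) = \<pi>1 e"
      unfolding extension_equivalence_def by (auto simp: X1.M_UNIV)
    have \<sigma>l: "linear_map E1 E2 \<sigma>"
      and \<sigma>s: "\<And>x e. e \<in> carrier_of E1 \<Longrightarrow> \<sigma> (star L E1 x e) = star L E2 x (\<sigma> e)"
      using \<sigma>(1) lmodule_hom_iff[OF X1.E.graded_action_axioms X2.E.graded_action_axioms] by auto
    note \<sigma>D = linear_mapD[OF \<sigma>l]
    \<comment> \<open>\<sigma> s1 and s2 are both sections of \<pi>2, so their difference comes from
      \<open>M\<close>.\<close>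
    have "\<exists>h. linear_map N M h \<and> (\<forall>n\<in>carrier_of N. \<iota>2 (h n) = \<sigma> (s1 n) - s2 n)"
      by (rule X2.lift_to_kernel)
        (simp_all add: X2.E.linear_map_diff linear_map_comp[OF s1l \<sigma>l] s2l X2.projD \<sigma>D s1D s2D \<sigma> p1 p2)
    then obtain h where h: "linear_map N M h" "\<And>n. \<iota>2 (h n) = \<sigma> (s1 n) - s2 n" by auto
    have "?cob h"
    proof (intro allI ballI)
      fix a x n assume x: "x \<in> hpart L a"
      have "\<sigma> (star L E1 x (s1 (twist N a n))) = \<sigma> (s1 (act N x n)) + \<iota>2 (\<phi>1 x n)"
        by (simp add: c1[OF x] \<sigma>D s1D X1.incD \<sigma>)
      then have "star L E2 x (\<sigma> (s1 (twist N a n))) = \<sigma> (s1 (act N x n)) + \<iota>2 (\<phi>1 x n)"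
        by (simp add: \<sigma>s s1D)
      moreover have "\<sigma> (s1 k) = s2 k + \<iota>2 (h k)" for k
        by (simp add: h)
      ultimately have "\<iota>2 (\<phi>2 x n + star L M x (h (twist N a n))) = \<iota>2 (h (act N x n) + \<phi>1 x n)"
        by (simp add: X2.E.star_add s2D X2.incD X2.inc_star c2[OF x])
      then show "\<phi>1 x n - \<phi>2 x n = star L M x (h (twist N a n)) - h (act N x n)"
        by (simp add: X2.inc_eq_iff algebra_simps)
    qed
    then show "\<exists>h. linear_map N M h \<and> ?cob h" using h by blast
  next
    assume "\<exists>h. linear_map N M h \<and> ?cob h"
    then obtain h where hl: "linear_map N M h"
      and h: "\<And>a x n. x \<in> hpart L a \<Longrightarrow> \<phi>1 x n - \<phi>2 x n = star L M x (h (twist N a n)) - h (act N x n)"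
      by auto
    note hD = linear_mapD[OF hl, simplified]
      linear_map_more[OF X1.N.superspace_axioms X1.M.superspace_axioms hl, simplified]
    obtain r where rl: "linear_map E1 M r" and r: "\<And>e. e \<in> carrier_of E1 \<Longrightarrow> e = s1 (\<pi>1 e) + \<iota>1 (r e)"
      and r': "\<And>n m. \<pi>1 (s1 n + \<iota>1 m) = n" "\<And>n m. r (s1 n + \<iota>1 m) = m"
      using X1.section_decomp[OF s1] by auto
    obtain q where q: "\<And>e. e \<in> carrier_of E2 \<Longrightarrow> e = s2 (\<pi>2 e) + \<iota>2 (q e)"
      and q': "\<And>n m. \<pi>2 (s2 n + \<iota>2 m) = n" "\<And>n m. q (s2 n + \<iota>2 m) = m"
      using X2.section_decomp[OF s2] by auto
    define \<sigma> where "\<sigma> e = s2 (\<pi>1 e) + \<iota>2 (h (\<pi>1 e) + r e)" for e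
    have \<sigma>_eq: "\<sigma> (s1 n + \<iota>1 m) = s2 n + \<iota>2 (h n + m)" for n m
      by (simp add: \<sigma>_def r')
    have carr1: "s1 n + \<iota>1 m \<in> carrier_of E1" for n m
      by (simp add: X1.E.carrier_add s1D X1.incD)
    have \<sigma>l: "linear_map E1 E2 \<sigma>"
      unfolding \<sigma>_def
      by (intro X2.E.linear_map_plus linear_map_comp[OF X1.proj_linear s2l]
          linear_map_comp[OF _ X2.inc_linear] X1.M.linear_map_plus linear_map_comp[OF X1.proj_linear hl] rl)
    have "\<sigma> \<in> lmodule_hom L E1 E2"
    proof (rule lmodule_homI[OF X1.E.graded_action_axioms X2.E.graded_action_axioms \<sigma>l])
      fix a x e assume x: "x \<in> hpart L a" and e: "e \<in> carrier_of E1"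
      \<comment> \<open>With this n the coordinate of e in \<open>N\<close> is \<delta>^a n, the
        argument that occurs in \<open>is_section\<close>.\<close>
      define n where "n = twist N a (\<pi>1 e)"
      have e_eq: "e = s1 (twist N a n) + \<iota>1 (r e)"
        using r[OF e] by (simp add: n_def)
      have "star L E1 x e = s1 (act N x n) + \<iota>1 (\<phi>1 x n + star L M x (r e))"
        by (subst e_eq) (simp add: X1.E.star_add s1D X1.incD X1.inc_star c1[OF x])
      then have "\<sigma> (star L E1 x e) = s2 (act N x n) + \<iota>2 (h (act N x n) + (\<phi>1 x n + star L M x (r e)))"
        by (simp only: \<sigma>_eq)
      also have "h (act N x n) + (\<phi>1 x n + star L M x (r e))
        = \<phi>2 x n + star L M x (h (twist N a n) + r e)"
        using h[OF x, of n] by (simp add: X1.M.star_add algebra_simps)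
      also have "s2 (act N x n) + \<iota>2 (\<phi>2 x n + star L M x (h (twist N a n) + r e))
        = star L E2 x (s2 (twist N a n) + \<iota>2 (h (twist N a n) + r e))"
        by (simp add: X2.E.star_add s2D X2.incD(1) X2.incD(2) X2.E.carrier_add X2.inc_star c2[OF x] X1.M.star_add add.assoc)
      also have "s2 (twist N a n) + \<iota>2 (h (twist N a n) + r e) = \<sigma> e"
        using arg_cong[OF e_eq, of \<sigma>] unfolding \<sigma>_eq by (rule sym)
      finally show "\<sigma> (star L E1 x e) = star L E2 x (\<sigma> e)" .
    qed
    moreover have "bij_betw \<sigma> (carrier_of E1) (carrier_of E2)"
      unfolding bij_betw_def
    proof
      show "inj_on \<sigma> (carrier_of E1)"
      proof (rule inj_onI)
        fix e f assume e: "e \<in> carrier_of E1" and f: "f \<in> carrier_of E1" and "\<sigma> e = \<sigma> f"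
        then have "\<pi>1 e = \<pi>1 f" "h (\<pi>1 e) + r e = h (\<pi>1 f) + r f"
          unfolding \<sigma>_def by (metis q'(1), metis q'(2))
        then show "e = f" using r[OF e] r[OF f] by simp
      qed
      have "e \<in> \<sigma> ` carrier_of E1" if e: "e \<in> carrier_of E2" for e
      proof -
        \<comment> \<open>The inverse of the triangular map \<sigma> subtracts h.\<close>
        have "e = \<sigma> (s1 (\<pi>2 e) + \<iota>1 (q e - h (\<pi>2 e)))"
          using q[OF e] by (simp add: \<sigma>_eq)
        then show ?thesis using carr1 by blast
      qed
      then show "\<sigma> ` carrier_of E1 = carrier_of E2"
        using linear_mapD(1)[OF \<sigma>l] by blast
    qed
    moreover have "\<sigma> (\<iota>1 m) = \<iota>2 m" for m
      using \<sigma>_eq[of 0 m] by (simp add: s1D s2D hD)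
    moreover have "\<pi>2 (\<sigma> e) = \<pi>1 e" for e
      by (simp add: \<sigma>_def q')
    ultimately show "((E1, \<iota>1, \<pi>1), (E2, \<iota>2, \<pi>2)) \<in> extension_equivalence L N M"
      unfolding extension_equivalence_def using X1.ext X2.ext by blast
  qed
qed


section \<open>Extensions from homogeneous cocycles\<close>

text \<open>
  A cocycle \<open>\<phi>\<close> of parity \<open>k\<close> defines the extension $M\times N$ in which the parity of \<open>M\<close> is shifted
  by \<open>k\<close>; the inclusion of \<open>M\<close> is then a homomorphism of parity \<open>k\<close>.
\<close>

definition cocycle_module ::
  "('f::field, 'l::ab_group_add, 'x) lie_superalgebra_scheme
    \<Rightarrow> ('f, 'l, 'n::ab_group_add, 'y) lmodule_scheme
    \<Rightarrow> ('f, 'l, 'm::ab_group_add, 'z) lmodule_scheme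
    \<Rightarrow> bit \<Rightarrow> ('l \<Rightarrow> 'n \<Rightarrow> 'm) \<Rightarrow> ('f, 'l, 'm \<times> 'n) lmodule" where
  "cocycle_module L N M k \<phi> =
     \<lparr>scale = (\<lambda>c. map_prod (scale M c) (scale N c)),
      hpart = (\<lambda>a. hpart M (k + a) \<times> hpart N a),
      act = (\<lambda>x (m, n). (act M (twist L k x) m + \<phi> x n, act N x n))\<rparr>"

lemma cocycle_module_simps [simp]:
  "scale (cocycle_module L N M k \<phi>) c (m, n) = (scale M c m, scale N c n)"
  "hpart (cocycle_module L N M k \<phi>) a = hpart M (k + a) \<times> hpart N a"
  "act (cocycle_module L N M k \<phi>) x (m, n) = (act M (twist L k x) m + \<phi> x n, act N x n)"
  by (simp_all add: cocycle_module_def)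

context restricted_pair
begin

lemma superspace_cocycle_module: "superspace (cocycle_module L N M k \<phi>)" (is "superspace ?P")
proof -
  interpret P: vector_space "scale ?P"
    by unfold_locales (auto simp: plus_prod_def M.scale_right_distrib M.scale_left_distrib
        N.scale_right_distrib N.scale_left_distrib)
  show ?thesis
  proof
    show "P.subspace (hpart ?P a)" for a
      by (rule P.subspaceI)
        (auto simp: zero_prod_def plus_prod_def M.hpart_add N.hpart_add M.hpart_scale N.hpart_scale)
    show "hpart ?P 0 \<inter> hpart ?P 1 = {0}"
    proof (intro equalityI subsetI)
      fix u assume "u \<in> hpart ?P 0 \<inter> hpart ?P 1"
      then show "u \<in> {0}"
        using M.hparts_disjoint[of "fst u" "k + 0" "k + 1"] N.hparts_disjoint[of "snd u" 0 1]
        by (auto simp: prod_eq_iff)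
    qed (simp add: zero_prod_def)
  qed
qed

lemma carrier_cocycle_module [simp]: "carrier_of (cocycle_module L N M k \<phi>) = UNIV"
proof -
  interpret P: superspace "cocycle_module L N M k \<phi>" by (rule superspace_cocycle_module)
  have "(m, n) \<in> carrier_of (cocycle_module L N M k \<phi>)" for m n
  proof -
    have "(m, n) = (component M (k + 0) m, component N 0 n) + (component M (k + 1) m, component N 1 n)"
      using M.component_sum[of m] N.component_sum[of n] by (cases k) (simp_all add: add.commute)
    moreover have "(component M (k + a) m, component N a n) \<in> hpart (cocycle_module L N M k \<phi>) a" for a
      by (simp add: M.component_in N.component_in)
    ultimately show ?thesis using P.carrier_add P.hpart_carrier by metis
  qed
  then show ?thesis by auto
qed

text \<open>An element of parity c in \<open>M\<close> has parity k + c in the product, whence the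
  factor (-1)^(ak).\<close>

lemma twist_cocycle_module:
  "twist (cocycle_module L N M k \<phi>) a (m, n) = (scale M (parity_sign (a * k)) (twist M a m), twist N a n)"
proof -
  interpret P: superspace "cocycle_module L N M k \<phi>" by (rule superspace_cocycle_module)
  have "component (cocycle_module L N M k \<phi>) b (m, n) = (component M (k + b) m, component N b n)" for b
  proof (rule P.component_unique)
    have "m - component M c m = component M (c + 1) m" "n - component N c n = component N (c + 1) n" for c
      using M.component_sum[of m] N.component_sum[of n]
      by (cases c, simp_all add: diff_eq_eq add.commute)+
    then show "(m, n) - (component M (k + b) m, component N b n) \<in> hpart (cocycle_module L N M k \<phi>) (b + 1)"
      by (simp add: M.component_in N.component_in add.assoc)
  qed (simp add: M.component_in N.component_in)
  then show ?thesis
    unfolding twist_def sum_bit by (cases a; cases k) simp_all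
qed

end


text \<open>Transport of structure to the image of an injective linear map, with the scalar
  multiplication of the surrounding type kept. It places an extension built on a product inside a
  prescribed type of middle terms.\<close>

lemma transport_module:
  fixes P :: "('f::field, 'l::ab_group_add, 'v::ab_group_add) lmodule"
    and j :: "'v \<Rightarrow> 'e::ab_group_add"
  assumes P: "restricted_module L P" "carrier_of P = UNIV"
    and j: "Vector_Spaces.linear (scale P) s j" "inj j"
  defines "E \<equiv> \<lparr>scale = s, hpart = (\<lambda>a. j ` hpart P a), act = (\<lambda>x e. j (act P x (inv j e)))\<rparr>"
  shows "restricted_module L E" "carrier_of E = range j" "j \<in> homogeneous_hom L P E 0"
proof -
  interpret P: restricted_module L P by fact
  interpret j: Vector_Spaces.linear "scale P" s j by fact
  have ij: "inv j (j v) = v" for v using j(2) by simp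
  have [simp]: "scale E = s" "hpart E a = j ` hpart P a" "act E x (j v) = j (act P x v)" for a x v
    by (simp_all add: E_def ij)
  have cP [simp]: "v \<in> carrier_of P" for v by (simp add: P(2))
  have "carrier_of E = {j u + j w |u w. u \<in> hpart P 0 \<and> w \<in> hpart P 1}"
    unfolding carrier_of_def by auto
  also have "\<dots> = j ` carrier_of P"
    unfolding carrier_of_def by (auto simp flip: j.add)
  finally show carrier: "carrier_of E = range j" by (simp add: P(2))
  interpret E: vector_space "scale E" using j.vs2.vector_space_axioms by simp
  have "superspace E"
  proof
    show "E.subspace (hpart E a)" for a
      using j.subspace_image[OF P.subspace_hpart] by simp
    show "hpart E 0 \<inter> hpart E 1 = {0}"
      using j(2) P.hparts_independent image_Int[OF j(2), of "hpart P 0" "hpart P 1"] j.zero by simp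
  qed
  then interpret E: superspace E .
  have iterate: "(act E x ^^ i) (j v) = j ((act P x ^^ i) v)" for x i v
    by (induction i) simp_all
  show "restricted_module L E"
  proof
    show "linear_map E E (act E x)" for x
      using P.linear_act_right[of x] unfolding linear_map_def carrier
      by (auto simp: P(2) simp flip: j.add j.scale)
    show "linear_map L E (\<lambda>x. act E x e)" if "e \<in> carrier_of E" for e
      using that P.linear_act_left unfolding linear_map_def carrier
      by (auto simp: P(2) j.add j.scale)
    show "act E x e \<in> hpart E (a + b)" if "x \<in> hpart L a" "e \<in> hpart E b" for a b x e
      using that P.act_even by auto
    show "act E (bracket L x y) e =
        act E x (act E y e) - scale E (parity_sign (a * b)) (act E y (act E x e))"
      if "x \<in> hpart L a" "y \<in> hpart L b" "e \<in> carrier_of E" for a b x y e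
      using that by (auto simp: carrier P.act_bracket j.diff j.scale)
    show "act E (pmap L x) e = (act E x ^^ CHAR('f)) e" if "x \<in> hpart L 0" "e \<in> carrier_of E" for x e
      using that by (auto simp: carrier P.act_pmap iterate)
  qed
  show "j \<in> homogeneous_hom L P E 0"
    unfolding homogeneous_hom_def linear_map_def by (auto simp: carrier j.add j.scale)
qed


section \<open>The extension defined by a homogeneous cocycle\<close>

context restricted_pair
begin

context
  fixes k \<phi>
  assumes Z: "\<phi> \<in> Z1 L (Hom_module L N M)" and k: "\<phi> \<in> hpart (Hom_space L (Hom_module L N M)) k"
begin

lemma cocycle_linear: "linear_map N M (\<phi> x)"
  by (rule Z1_D(1)[OF Z])

lemmas cocycleD = Z1_D(2,3)[OF Z] linear_mapD(2,3)[OF cocycle_linear, simplified]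
  linear_map_more[OF N.superspace_axioms M.superspace_axioms cocycle_linear, simplified]

lemma cocycle_hpart: "x \<in> hpart L a \<Longrightarrow> n \<in> hpart N b \<Longrightarrow> \<phi> x n \<in> hpart M (k + a + b)"
  using k by auto

text \<open>\<phi>(x) has parity k + a, so it commutes with \<delta>^b up to the sign
  (-1)^(b(k+a)).\<close>

lemma cocycle_twist:
  assumes "x \<in> hpart L a"
  shows "twist M b (\<phi> x n) = scale M (parity_sign (b * (k + a))) (\<phi> x (twist N b n))"
  using NM.V_carrier[of n]
proof (induction rule: N.carrier_induct)
  case (add u v)
  then show ?case by (simp add: cocycleD M.twist_add N.twist_add M.scale_right_distrib)
next
  case (homogeneous c v)
  then show ?case
    using M.twist_homogeneous[OF cocycle_hpart[OF assms homogeneous], of b]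
    by (simp add: N.twist_homogeneous cocycleD distrib_left parity_sign_add)
qed

text \<open>The cocycle identity in terms of \<open>act\<close>. With the signs (-1)^(ak), by which
  elements of \<open>L\<close> act on the shifted copy of \<open>M\<close>, it is the
  \<open>M\<close>-coordinate of the bracket relation on vectors (0, n) of
  \<open>cocycle_module\<close>.\<close>

lemma cocycle_bracket:
  assumes x: "x \<in> hpart L a" and y: "y \<in> hpart L b"
  shows "\<phi> (bracket L x y) n = scale M (parity_sign (a * k)) (act M x (\<phi> y n)) + \<phi> x (act N y n)
    - scale M (parity_sign (a * b)) (scale M (parity_sign (b * k)) (act M y (\<phi> x n)) + \<phi> y (act N x n))"
proof -
  have "linear_map L (Hom_module L N M) \<phi>" using Z HM.Z1_iff by blast
  from Z[unfolded Z1_Hom_iff[OF this]] x y have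
    "\<phi> (bracket L x y) n = scale M (parity_sign (a * b)) (star L M x (\<phi> y (twist N a n)) - \<phi> y (act N x n))
      - (star L M y (\<phi> x (twist N b n)) - \<phi> x (act N y n))" by blast
  also have "star L M x (\<phi> y (twist N a n)) = scale M (parity_sign (a * (k + b))) (act M x (\<phi> y n))"
    by (simp add: M.star_homogeneous[OF x] cocycle_twist[OF y] M.act_scale)
  also have "star L M y (\<phi> x (twist N b n)) = scale M (parity_sign (b * (k + a))) (act M y (\<phi> x n))"
    by (simp add: M.star_homogeneous[OF y] cocycle_twist[OF x] M.act_scale)
  finally show ?thesis
    by (cases a; cases b; cases k) (simp_all add: algebra_simps)
qed

text \<open>The action is block triangular. The diagonal blocks inherit the module laws from
  \<open>M\<close> and \<open>N\<close>; for the corner block the bracket relation is the cocycle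
  identity and the p-th power relation is the vanishing of \<open>ind1\<close>.\<close>

lemma restricted_module_cocycle: "restricted_module L (cocycle_module L N M k \<phi>)"
  (is "restricted_module L ?P")
proof -
  interpret P: superspace ?P by (rule superspace_cocycle_module)
  have tw: "act M (twist L k x) m = scale M (parity_sign (a * k)) (act M x m)" if "x \<in> hpart L a" for x a m
    using that by (simp add: N.L.twist_homogeneous M.act_scale_left mult.commute)
  show ?thesis
  proof
    show "linear_map ?P ?P (act ?P x)" for x
      unfolding linear_map_def
      by (auto simp: M.act_add N.act_add M.act_scale N.act_scale cocycleD M.scale_right_distrib algebra_simps)
    show "linear_map L ?P (\<lambda>x. act ?P x u)" for u
      unfolding linear_map_def
      by (cases u) (auto simp: M.act_add_left N.act_add_left M.act_scale_left N.act_scale_left cocycleD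
          N.L.twist_add N.L.twist_scale M.scale_right_distrib algebra_simps)
    show "act ?P x u \<in> hpart ?P (a + b)" if x: "x \<in> hpart L a" and u: "u \<in> hpart ?P b" for a b x u
    proof -
      obtain m n where mn: "u = (m, n)" "m \<in> hpart M (k + b)" "n \<in> hpart N b" using u by auto
      have "act M x m \<in> hpart M (k + (a + b))" "\<phi> x n \<in> hpart M (k + (a + b))"
        using M.even_action[OF x mn(2)] cocycle_hpart[OF x mn(3)] by (simp_all add: ac_simps)
      then show ?thesis
        using mn N.even_action[OF x mn(3)] by (simp add: tw[OF x] M.hpart_add M.hpart_scale)
    qed
    show "act ?P (bracket L x y) u =
        act ?P x (act ?P y u) - scale ?P (parity_sign (a * b)) (act ?P y (act ?P x u))"
      if x: "x \<in> hpart L a" and y: "y \<in> hpart L b" for a b x y u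
    proof (cases u)
      case (Pair m n)
      show ?thesis
        unfolding Pair cocycle_module_simps tw[OF x] tw[OF y] tw[OF N.L.bracket_even[OF x y]]
          cocycle_bracket[OF x y] RM.act_bracket[OF x y M_carrier] RN.act_bracket[OF x y NM.V_carrier]
        by (cases a; cases b; cases k) (simp_all add: M.act_add M.act_neg M.act_diff cocycleD algebra_simps)
    qed
    show "act ?P (pmap L z) u = (act ?P z ^^ CHAR('f)) u" if z: "z \<in> hpart L 0" for z u
    proof (cases u)
      case (Pair m n)
      have tw0: "twist L k y = y" if "y \<in> hpart L 0" for y
        using N.L.twist_homogeneous[OF that] by simp
      have act_sum: "act M z (sum g A) = (\<Sum>i\<in>A. act M z (g i))" if "finite A" for g and A :: "nat set"
        using that by (induction A rule: finite_induct) (simp_all add: M.act_add)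
      \<comment> \<open>The corner block of the i-th power of a triangular operator. The sum is
        empty for i = 0 and has l < i otherwise, so the exponents are true differences.\<close>
      have "(act ?P z ^^ i) (m, n) = ((act M z ^^ i) m +
        (\<Sum>l<i. (act M z ^^ (i - 1 - l)) (\<phi> z ((act N z ^^ l) n))), (act N z ^^ i) n)" for i
      proof (induction i)
        case (Suc i)
        have "act M z (\<Sum>l<i. (act M z ^^ (i - 1 - l)) (\<phi> z ((act N z ^^ l) n)))
          = (\<Sum>l<i. (act M z ^^ (Suc i - 1 - l)) (\<phi> z ((act N z ^^ l) n)))"
          unfolding act_sum[OF finite_lessThan]
          by (intro sum.cong refl) (simp flip: funpow.simps(2)[THEN fun_cong, unfolded o_def] add: Suc_diff_Suc)
        then show ?case using Suc by (simp add: tw0[OF z] M.act_add add.assoc)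
      qed (simp add: zero_prod_def)
      moreover have "\<phi> (pmap L z) n =
          (\<Sum>i<CHAR('f). (act M z ^^ (CHAR('f) - 1 - i)) (\<phi> z ((act N z ^^ i) n)))"
        using Z z HM.Z1_iff Z1_Hom_iff by blast
      ultimately show ?thesis
        unfolding Pair
        by (simp add: tw0 z R.pmap_closed RM.act_pmap RN.act_pmap)
    qed
  qed
qed

text \<open>The sign (-1)^(ak) of the shifted action cancels that of the twist on the shifted
  summand. So \<open>star\<close> on \<open>M\<close> is the original one, and m \<mapsto> (m, 0)
  commutes with it whatever k is.\<close>

lemma star_cocycle_module:
  assumes x: "x \<in> hpart L a"
  shows "star L (cocycle_module L N M k \<phi>) x (m, n) =
    (star L M x m + \<phi> x (twist N a n), star L N x n)"
proof -
  interpret P: graded_action L "cocycle_module L N M k \<phi>"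
    by (rule restricted_module.graded_actionI[OF restricted_module_cocycle lie_L])
  show ?thesis
    by (simp add: P.star_homogeneous[OF x] M.star_homogeneous[OF x] N.star_homogeneous[OF x]
        twist_cocycle_module N.L.twist_homogeneous[OF x] M.act_scale_left M.act_scale mult.commute)
qed

text \<open>The cocycle module is copied into the type of middle terms; there the image of n
  \<mapsto> (0, n) is a section with cocycle \<phi>.\<close>

lemma homogeneous_extension:
  assumes "large_enough TYPE('e::ab_group_add) N M"
  shows "\<exists>(E :: ('f, 'l, 'e) lmodule) \<iota> \<pi> s. restricted_extension L N M E \<iota> \<pi> \<and>
    restricted_extension.is_section L N E \<iota> \<pi> s \<phi>"
proof -
  let ?P = "cocycle_module L N M k \<phi>"
  obtain s :: "'f \<Rightarrow> 'e \<Rightarrow> 'e" and j :: "'m \<times> 'n \<Rightarrow> 'e"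
    where j: "Vector_Spaces.linear (\<lambda>c. map_prod (scale M c) (scale N c)) s j" "inj j"
    using assms unfolding large_enough_def by blast
  interpret P: restricted_module L ?P by (rule restricted_module_cocycle)
  interpret P: graded_action L ?P by (rule P.graded_actionI[OF lie_L])
  have "Vector_Spaces.linear (scale ?P) s j" using j(1) by (simp add: cocycle_module_def)
  note tm = transport_module[OF P.restricted_module_axioms carrier_cocycle_module this j(2)]
  define E where "E = \<lparr>scale = s, hpart = (\<lambda>a. j ` hpart ?P a), act = (\<lambda>x e. j (act ?P x (inv j e)))\<rparr>"
  note tE = tm[folded E_def]
  interpret E: restricted_module L E by (rule tE(1))
  interpret E: graded_action L E by (rule E.graded_actionI[OF lie_L])
  have jl: "linear_map ?P E j" using tE(3) by (simp add: homogeneous_hom_def)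
  note jD = linear_mapD[OF jl, simplified]
  have js: "star L E x (j u) = j (star L ?P x u)" for x u
    using homogeneous_hom_star[OF P.graded_action_axioms E.graded_action_axioms tE(3), of u x] by simp
  have ij [simp]: "inv j (j u) = u" for u using j(2) by simp
  have j_eq [simp]: "j u = j v \<longleftrightarrow> u = v" for u v using j(2) by (simp add: inj_eq)
  have j0: "j 0 = 0"
    by (rule linear_map_more(1)[OF P.superspace_axioms E.superspace_axioms jl])
  define \<iota> where "\<iota> m = j (m, 0)" for m
  define \<pi> where "\<pi> e = snd (inv j e)" for e
  have inc: "\<iota> \<in> lmodule_hom L M E"
  proof (rule lmodule_homI[OF M.graded_action_axioms E.graded_action_axioms])
    show "linear_map M E \<iota>"
      unfolding linear_map_def \<iota>_def by (simp add: jD(1) flip: jD(2,3))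
    show "\<iota> (star L M x m) = star L E x (\<iota> m)" if "x \<in> hpart L a" for a x m
      by (simp add: \<iota>_def js star_cocycle_module[OF that] cocycleD)
  qed
  have proj: "\<pi> \<in> lmodule_hom L E N"
  proof (rule lmodule_homI[OF E.graded_action_axioms N.graded_action_axioms])
    show "linear_map E N \<pi>"
      unfolding linear_map_def \<pi>_def tE(2) by (auto simp flip: jD(2,3))
    show "\<pi> (star L E x e) = star L N x (\<pi> e)" if "x \<in> hpart L a" "e \<in> carrier_of E" for a x e
      using that(2) by (auto simp: \<pi>_def tE(2) js star_cocycle_module[OF that(1)])
  qed
  have "(E, \<iota>, \<pi>) \<in> restricted_extensions L N M"
    unfolding restricted_extensions_def
  proof (clarify, intro conjI)
    show "inj_on \<iota> (carrier_of M)" by (simp add: inj_on_def \<iota>_def)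
    show "\<iota> ` carrier_of M = {e \<in> carrier_of E. \<pi> e = 0}"
      by (auto simp: \<iota>_def \<pi>_def tE(2) M_UNIV)
    show "\<pi> ` carrier_of E = carrier_of N"
      by (force simp: \<pi>_def tE(2) N_UNIV image_iff)
  qed (use inc proj tE(1) in auto)
  then interpret X: restricted_extension L N M E \<iota> \<pi> by unfold_locales
  have "X.is_section (\<lambda>n. j (0, n)) \<phi>"
    unfolding X.is_section_def
  proof (intro conjI allI ballI)
    show "linear_map N E (\<lambda>n. j (0, n))"
      unfolding linear_map_def by (simp add: jD(1) flip: jD(2,3))
    show "\<pi> (j (0, n)) = n" for n by (simp add: \<pi>_def)
    show "star L E x (j (0, twist N a n)) = j (0, act N x n) + \<iota> (\<phi> x n)" if "x \<in> hpart L a" for a x n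
      by (simp add: \<iota>_def js star_cocycle_module[OF that] N.star_homogeneous[OF that] flip: jD(2))
  qed
  then show ?thesis using X.restricted_extension_axioms by blast
qed

end

text \<open>Choosing a cocycle for each extension identifies \<open>Ext_res\<close> with the set of
  attained classes. This set contains all homogeneous classes, so the cardinality argument gives a
  bijection with all of \<open>H1\<close>, which need not be the map induced by the chosen
  cocycles.\<close>

lemma Ext_res_bij_H1:
  assumes inf: "infinite (UNIV :: 'f set)" and large: "large_enough TYPE('e::ab_group_add) N M"
  shows "\<exists>\<Phi>. bij_betw \<Phi> (Ext_res L N M :: ('f, 'l, 'n, 'm, 'e) extension set set)
    (H1 L (Hom_module L N M))"
proof -
  let ?V = "Hom_module L N M"
  let ?X = "restricted_extensions L N M :: ('f, 'l, 'n, 'm, 'e) extension set"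
  define of_ext where "of_ext X \<phi> \<longleftrightarrow> \<phi> \<in> Z1 L ?V \<and> (case X of (E, \<iota>, \<pi>) \<Rightarrow>
    \<exists>s. restricted_extension.is_section L N E \<iota> \<pi> s \<phi>)"
    for X :: "('f, 'l, 'n, 'm, 'e) extension" and \<phi>
  have ext: "restricted_extension L N M E \<iota> \<pi>" if "(E, \<iota>, \<pi>) \<in> ?X" for E \<iota> \<pi>
    using that by (intro restricted_extension.intro restricted_pair_axioms restricted_extension_axioms.intro)
  have "\<exists>\<phi>. of_ext X \<phi>" if "X \<in> ?X" for X
  proof (cases X)
    case (fields E \<iota> \<pi>)
    then show ?thesis
      using restricted_extension.ex_cocycle[OF ext[of E \<iota> \<pi>]] that by (simp add: of_ext_def Bex_def)
  qed
  then obtain c where c: "\<And>X. X \<in> ?X \<Longrightarrow> of_ext X (c X)" by metis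
  have equiv_iff: "(X, Y) \<in> extension_equivalence L N M \<longleftrightarrow> \<phi> - \<psi> \<in> B1 L ?V"
    if "X \<in> ?X" "Y \<in> ?X" "of_ext X \<phi>" "of_ext Y \<psi>" for X Y \<phi> \<psi>
    using that equivalent_iff_cohomologous[OF ext ext] unfolding of_ext_def
    by (cases X; cases Y) auto
  have cZ: "c X \<in> Z1 L ?V" if "X \<in> ?X" for X
    using c[OF that] by (simp add: of_ext_def)
  let ?R = "cohomologous L ?V"
  let ?S = "(\<lambda>X. ?R `` {c X}) ` ?X"
  have "extension_equivalence L N M = {(X, Y). X \<in> ?X \<and> Y \<in> ?X \<and> (c X, c Y) \<in> ?R}"
  proof -
    have "(X, Y) \<in> extension_equivalence L N M \<Longrightarrow> X \<in> ?X \<and> Y \<in> ?X" for X Y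
      unfolding extension_equivalence_def by auto
    moreover have "(c X, c Y) \<in> ?R \<longleftrightarrow> (X, Y) \<in> extension_equivalence L N M" if "X \<in> ?X" "Y \<in> ?X" for X Y
      using equiv_iff[OF that c[OF that(1)] c[OF that(2)]] cZ that by (simp add: cohomologous_def)
    ultimately show ?thesis by auto
  qed
  from quotient_bij_betw[OF HM.equiv_cohomologous cZ this]
  obtain \<Phi> where \<Phi>: "bij_betw \<Phi> (Ext_res L N M :: ('f, 'l, 'n, 'm, 'e) extension set set) ?S"
    unfolding Ext_res_def by blast
  have "\<exists>g. bij_betw g ?S (H1 L ?V)"
  proof (rule HM.H1_bij_betw_subset[OF inf R.restricted_lie_superalgebra_axioms])
    show "?S \<subseteq> H1 L ?V"
      unfolding H1_eq using cZ by (auto intro: quotientI)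
    fix k \<phi> assume \<phi>: "\<phi> \<in> Z1 L ?V" "\<phi> \<in> hpart (Hom_space L ?V) k"
    obtain E :: "('f, 'l, 'e) lmodule" and \<iota> \<pi> s where X: "restricted_extension L N M E \<iota> \<pi>"
      "restricted_extension.is_section L N E \<iota> \<pi> s \<phi>"
      using homogeneous_extension[OF \<phi> large] by blast
    interpret X: restricted_extension L N M E \<iota> \<pi> by (rule X(1))
    have "of_ext (E, \<iota>, \<pi>) \<phi>" using X(2) \<phi>(1) by (auto simp: of_ext_def)
    \<comment> \<open>The cocycle chosen for this extension may differ from \<phi>; comparing the
      extension with itself shows that the two are cohomologous.\<close>
    moreover have "((E, \<iota>, \<pi>), (E, \<iota>, \<pi>)) \<in> extension_equivalence L N M"
    proof -
      have "id \<in> lmodule_hom L E E"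
        by (rule lmodule_homI[OF X.E.graded_action_axioms X.E.graded_action_axioms])
          (simp_all add: linear_map_def)
      then show ?thesis unfolding extension_equivalence_def using X.ext by auto
    qed
    ultimately have "c (E, \<iota>, \<pi>) - \<phi> \<in> B1 L ?V"
      using equiv_iff[OF X.ext X.ext c[OF X.ext]] by blast
    then have "(c (E, \<iota>, \<pi>), \<phi>) \<in> ?R" using cZ[OF X.ext] \<phi>(1) by (simp add: cohomologous_def)
    then have "?R `` {\<phi>} = ?R `` {c (E, \<iota>, \<pi>)}"
      by (rule equiv_class_eq[OF HM.equiv_cohomologous, symmetric])
    then show "?R `` {\<phi>} \<in> ?S"
      by (rule image_eqI) (rule X.ext)
  qed
  then show ?thesis using bij_betw_trans[OF \<Phi>] by blast
qed

end


section \<open>The trivial module\<close>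

lemma trivial_module_simps [simp]:
  "scale trivial_module = (*)" "hpart trivial_module a = (if a = 0 then UNIV else {0})"
  "act trivial_module x v = 0"
  by (simp_all add: trivial_module_def)

lemma carrier_trivial_module: "carrier_of (trivial_module :: ('f::field, 'l, 'f) lmodule) = UNIV"
  by (simp add: carrier_of_def)

lemma restricted_module_trivial:
  assumes "CHAR('f::field) > 0"
  shows "restricted_module L (trivial_module :: ('f, 'l::ab_group_add, 'f) lmodule)"
proof -
  let ?T = "trivial_module :: ('f, 'l, 'f) lmodule"
  interpret T: vector_space "scale ?T"
    by unfold_locales (simp_all add: algebra_simps)
  interpret T: superspace ?T
    by unfold_locales (simp_all add: T.subspace_def[unfolded trivial_module_simps])
  show ?thesis
  proof
    \<comment> \<open>Both sides are 0 because the exponent is positive; a 0-th power would be the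
      identity.\<close>
    show "act ?T (pmap L x) v = (act ?T x ^^ CHAR('f)) v" for x v
      using assms by (cases "CHAR('f)") simp_all
  qed (simp_all add: linear_map_def carrier_trivial_module)
qed

text \<open>A linear map on the ground field is determined by its value at 1. As the ground field is
  purely even with zero action, m \<mapsto> (c \<mapsto> c m) is an even isomorphism of
  \<open>M\<close> with the module of linear maps.\<close>

lemma H1_Hom_trivial:
  fixes M :: "('f::field, 'l::ab_group_add, 'm::ab_group_add, 'z) lmodule_scheme"
  assumes "action_pair L (trivial_module :: ('f, 'l, 'f) lmodule) M"
  shows "\<exists>\<Phi>. bij_betw \<Phi> (H1 L M) (H1 L (Hom_module L (trivial_module :: ('f, 'l, 'f) lmodule) M))"
proof -
  let ?T = "trivial_module :: ('f, 'l, 'f) lmodule"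
  let ?H = "Hom_module L ?T M"
  interpret action_pair L ?T M by fact
  let ?J = "\<lambda>m c. scale M c m"
  have lin: "linear_map ?T M (?J m)" for m
    by (simp add: linear_map_def M.scale_left_distrib)
  have "act ?H x (?J m) = ?J (act M x m)" if "x \<in> hpart L a" for a x m
    by (simp add: fun_eq_iff act_Hom_homogeneous[OF lin that] M.act_scale)
  moreover have "linear_map M ?H ?J"
    unfolding linear_map_def[of M ?H]
    by (simp add: Hom_module_eqs lin fun_eq_iff M.scale_right_distrib mult.commute)
  ultimately have "?J \<in> homogeneous_hom L M ?H 0"
    unfolding homogeneous_hom_def by (simp add: lin M.hpart_scale)
  moreover have "bij_betw ?J (carrier_of M) (carrier_of ?H)"
  proof (rule bij_betwI')
    show "?J m = ?J m' \<longleftrightarrow> m = m'" for m m'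
      using M.scale_one by (auto dest: fun_cong[of _ _ 1])
    show "?J m \<in> carrier_of ?H" for m
      by (simp add: Hom_module_eqs lin)
    fix f assume "f \<in> carrier_of ?H"
    then have f: "linear_map ?T M f" by (simp add: Hom_module_eqs)
    have "f c = scale M c (f 1)" for c
      using linear_mapD(3)[OF f, of 1 c] by simp
    then show "\<exists>m\<in>carrier_of M. f = ?J m"
      by (intro bexI[of _ "f 1"] ext M_carrier)
  qed
  ultimately show ?thesis
    by (rule H1_iso[OF M.graded_action_axioms HM.graded_action_axioms])
qed

theorem theorem3p4:
  fixes L :: "('f::alg_closed_field, 'l::ab_group_add) lie_superalgebra"
    and M :: "('f, 'l, 'm::ab_group_add) lmodule"
    and N :: "('f, 'l, 'n::ab_group_add) lmodule"
  assumes char: "CHAR('f) > 2"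
    and L: "restricted_lie_superalgebra L"
    and M: "restricted_module L M" "carrier_of M = UNIV"
    and N: "restricted_module L N" "carrier_of N = UNIV"
    and large_N: "large_enough TYPE('e::ab_group_add) N M"
    and large_F: "large_enough TYPE('d::ab_group_add) (trivial_module :: ('f, 'l, 'f) lmodule) M"
  shows "(\<exists>\<Phi>. bij_betw \<Phi> (Ext_res L N M :: ('f, 'l, 'n, 'm, 'e) extension set set)
              (H1 L (Hom_module L N M))) \<and>
         (\<exists>\<Psi>. bij_betw \<Psi> (Ext_res L trivial_module M :: ('f, 'l, 'f, 'm, 'd) extension set set)
              (H1 L M))"
proof
  let ?T = "trivial_module :: ('f, 'l, 'f) lmodule"
  have p: "CHAR('f) > 0" using char by simp
  have lie: "lie_superalgebra L"
    using L by (simp add: restricted_lie_superalgebra_def)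
  \<comment> \<open>Stated for any K, since both \<open>N\<close> and the trivial module take its
    place.\<close>
  have pair: "restricted_pair L K M"
    if K: "restricted_module L K" "carrier_of K = UNIV" for K :: "('f, 'l, 'k::ab_group_add) lmodule"
    using K M L p lie restricted_module.graded_actionI[OF K(1) lie] restricted_module.graded_actionI[OF M(1) lie]
    by (simp add: restricted_pair_def restricted_pair_axioms_def action_pair_def action_pair_axioms_def)
  note inf = infinite_alg_closed_field[where 'a = 'f]
  show "\<exists>\<Phi>. bij_betw \<Phi> (Ext_res L N M :: ('f, 'l, 'n, 'm, 'e) extension set set)
    (H1 L (Hom_module L N M))"
    by (rule restricted_pair.Ext_res_bij_H1[OF pair[OF N] inf large_N])
  have T: "restricted_pair L ?T M"
    by (rule pair[OF restricted_module_trivial[OF p] carrier_trivial_module])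
  obtain \<Phi> where \<Phi>: "bij_betw \<Phi> (Ext_res L ?T M :: ('f, 'l, 'f, 'm, 'd) extension set set)
    (H1 L (Hom_module L ?T M))"
    using restricted_pair.Ext_res_bij_H1[OF T inf large_F] by blast
  obtain \<Psi> where "bij_betw \<Psi> (H1 L M) (H1 L (Hom_module L ?T M))"
    using H1_Hom_trivial T unfolding restricted_pair_def by blast
  \<comment> \<open>The bijection of \<open>H1_Hom_trivial\<close> starts at \<open>H1 L M\<close>,
    so it is inverted before composing.\<close>
  from bij_betw_trans[OF \<Phi> bij_betw_inv_into[OF this]]
  show "\<exists>\<Psi>. bij_betw \<Psi> (Ext_res L trivial_module M :: ('f, 'l, 'f, 'm, 'd) extension set set) (H1 L M)"
    by blast
qed

end
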